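(* Let $a,b,c,d$ be positive real numbers with $\min\{c,d\}>\max\{a,b\}$, and let $\{P_n(x)\}_{n\in\mathbb{N}}$, $P_n(x):=P_n(x;a,b;c,d)$, be the monic $2$-orthogonal polynomial sequence with respect to the weight vector $\overline{\mathcal{W}}(x;a,b;c,d)$. For $n\ge1$ let $\nu_n=\frac1n\sum_{P_n(x)=0}\delta_x$ be the normalised zero counting measure of $P_n$, where $\delta_x$ is the Dirac point mass at $x$ (the zeros of $P_n$ are simple and lie in $(0,1)$). Then $\nu_n$ converges weakly, as $n\to\infty$, to the measure $\nu$ on $[0,1]$ with density $$\frac{\mathrm{d}\nu}{\mathrm{d}x}=\frac{\sqrt3}{4\pi}\,\frac{\left(1+\sqrt{1-x}\right)^{1/3}+\left(1-\sqrt{1-x}\right)^{1/3}}{x^{2/3}\sqrt{1-x}}\quad\text{for }x\in(0,1)$$ and $0$ elsewhere; that is, $\lim_{n\to\infty}\int f\,\mathrm{d}\nu_n=\int f\,\mathrm{d}\nu$ for every bounded continuous function $f$ on $[0,1]$.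
   Context: $\mathbb{N}=\{0,1,2,\dots\}$. For positive reals $a,b,c,d$ with $\delta:=c+d-a-b>0$, the function $\mathcal{W}(\cdot\,;a,b;c,d)$ on $(0,1)$ is $$\mathcal{W}(x;a,b;c,d)=\frac{\Gamma(c)\Gamma(d)}{\Gamma(a)\Gamma(b)\Gamma(\delta)}\,x^{a-1}(1-x)^{\delta-1}\,{}_2F_1(c-b,d-b;\delta;1-x),$$ where ${}_2F_1(\alpha,\beta;\gamma;z)=\sum_{n\ge0}\frac{(\alpha)_n(\beta)_n}{(\gamma)_n}\frac{z^n}{n!}$ for $|z|<1$, with $(z)_0=1$, $(z)_n=z(z+1)\cdots(z+n-1)$. (The condition $\min\{c,d\}>\max\{a,b\}$ implies $\delta>0$.) The weight vector $\overline{\mathcal{W}}(x;a,b;c,d)$ has components $w_0(x)=\mathcal{W}(x;a,b;c,d)$ and $w_1(x)=\mathcal{W}(x;a,b+1;c+1,d)$. A sequence of monic polynomials $\{P_n\}_{n\in\mathbb{N}}$ with $\deg P_n=n$ is the monic $2$-orthogonal polynomial sequence with respect to $\overline{\mathcal{W}}(x;a,b;c,d)$ if, for each $j\in\{0,1\}$ and $k,n\in\mathbb{N}$, $\int_0^1x^kP_n(x)w_j(x)\,\mathrm{d}x$ equals $0$ if $n\ge 2k+j+1$ and is nonzero if $n=2k+j$. For these weights it exists and is unique. *)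

theory Defs
  imports "HOL-Analysis.Analysis" "HOL-Computational_Algebra.Polynomial"
begin

(* Only used for real |z| < 1, where the series converges absolutely. *)
definition hyp2F1 :: "real \<Rightarrow> real \<Rightarrow> real \<Rightarrow> real \<Rightarrow> real" where
  "hyp2F1 \<alpha> \<beta> \<gamma> z =
     (\<Sum>n. pochhammer \<alpha> n * pochhammer \<beta> n / pochhammer \<gamma> n * (z ^ n / fact n))"

(* Only the values at 0 < x < 1 are meaningful. *)
definition weight_W :: "real \<Rightarrow> real \<Rightarrow> real \<Rightarrow> real \<Rightarrow> real \<Rightarrow> real" where
  "weight_W a b c d x =
     (let \<delta> = c + d - a - b in
        Gamma c * Gamma d / (Gamma a * Gamma b * Gamma \<delta>)
          * x powr (a - 1) * (1 - x) powr (\<delta> - 1)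
          * hyp2F1 (c - b) (d - b) \<delta> (1 - x))"

(* The two components are those at j = 0 and j = 1. *)
definition weight_vec :: "real \<Rightarrow> real \<Rightarrow> real \<Rightarrow> real \<Rightarrow> nat \<Rightarrow> real \<Rightarrow> real" where
  "weight_vec a b c d j =
     (if j = 0 then weight_W a b c d else weight_W a (b + 1) (c + 1) d)"

definition monic_2_orthogonal :: "(nat \<Rightarrow> real \<Rightarrow> real) \<Rightarrow> (nat \<Rightarrow> real poly) \<Rightarrow> bool" where
  "monic_2_orthogonal w P \<longleftrightarrow>
     (\<forall>n. degree (P n) = n \<and> lead_coeff (P n) = 1) \<and>
     (\<forall>j\<in>{0, 1}. \<forall>k n.
        (2 * k + j + 1 \<le> n \<longrightarrow>
           (LINT x:{0<..<1}|lborel. x ^ k * poly (P n) x * w j x) = 0) \<and>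
        (n = 2 * k + j \<longrightarrow>
           (LINT x:{0<..<1}|lborel. x ^ k * poly (P n) x * w j x) \<noteq> 0))"

(* (1 / deg p) times the sum of the Dirac masses at the distinct real zeros of p,
   as a Borel measure on the real line. It is normalised by the degree, not by
   the number of zeros. *)
definition zero_counting_measure :: "real poly \<Rightarrow> real measure" where
  "zero_counting_measure p =
     scale_measure (ennreal (1 / real (degree p)))
       (distr (count_space {x. poly p x = 0}) borel (\<lambda>x. x))"

lemma emeasure_zero_counting_measure:
  assumes "p \<noteq> 0" and "A \<in> sets borel"
  shows "emeasure (zero_counting_measure p) A =
    ennreal (real (card {x \<in> A. poly p x = 0}) / real (degree p))"
proof -
  have fin: "finite {x. poly p x = 0}"
    using assms(1) by (rule poly_roots_finite)
  have eq: "(\<lambda>x. x) -` A \<inter> space (count_space {x. poly p x = 0}) = {x \<in> A. poly p x = 0}"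
    by auto
  have "emeasure (distr (count_space {x. poly p x = 0}) borel (\<lambda>x. x)) A
      = of_nat (card {x \<in> A. poly p x = 0})"
    by (subst emeasure_distr) (use assms fin in \<open>auto simp: eq Int_def intro!: emeasure_count_space_finite\<close>)
  then show ?thesis
    unfolding zero_counting_measure_def
    by (simp add: ennreal_of_nat_eq_real_of_nat flip: ennreal_mult')
qed

definition limit_density :: "real \<Rightarrow> real" where
  "limit_density x =
     (if x \<in> {0<..<1} then
        sqrt 3 / (4 * pi)
          * (((1 + sqrt (1 - x)) powr (1 / 3) + (1 - sqrt (1 - x)) powr (1 / 3))
             / (x powr (2 / 3) * sqrt (1 - x)))
      else 0)"

definition limit_measure :: "real measure" where
  "limit_measure = density lborel (\<lambda>x. ennreal (limit_density x))"

end

(*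
  The monic 2-orthogonal polynomial P_n is the monic multiple of
  3F2(-n, c + floor(n/2), d + floor((n-1)/2); a, b; x): the moments of the weights are known from
  Gauss' summation theorem, and the orthogonality becomes the vanishing of n-th differences of
  polynomials of degree < n. Contiguous relations link three families with shifted parameters by
  A' = x C - g A, B' = A' - g B, C' = B' - g C with g > 0, which forces interlacing, so that P_n has
  n simple positive zeros. The hypergeometric differential equation is a Riccati type equation for
  the generating function h of the power sums of the zeros. After scaling by n its limit
  is (u - 1)(u + 1/2)^2 = z u^3, and hence the moments of the zero counting measures converge to
  (1/3)_k (2/3)_k / ((1/2)_k k!). These are the moments of W(x; 2/3, 1/3; 1/2, 1), which is exactly
  the limit density because its 2F1 is the even part of a binomial series.
*)

theory Submission
  imports Defs "HOL-Real_Asymp.Real_Asymp" "HOL-Computational_Algebra.Fundamental_Theorem_Algebra"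
    "HOL-Computational_Algebra.Polynomial_FPS"
begin

section \<open>Moments of the weights\<close>

text \<open>Interlacing is never argued with ordered lists of zeros. It is encoded by signs of an
  antisymmetric bilinear form on polynomials, and the same induction is run for two forms: one
  excludes nonreal zeros, the other multiple positive zeros. Positivity of all multipliers
  \<open>g\<close> makes the signs add up, and this is where \<open>min c d > max a b\<close>
  enters.

  An obstacle on the side of the weights: the second component has the parameter
  \<open>d - (b + 1)\<close>, which may be negative, so its series cannot be integrated as a series
  of nonnegative terms. It is reached through a contiguous relation between weights whose parameters
  are positive.

  The cubic comes from the factored hypergeometric operator: with \<theta> = x d/dx the equation of
  P_n has the factors (\<theta> - n)(\<theta> + C)(\<theta> + D) against \<theta>(\<theta> + a -
  1)(\<theta> + b - 1). On the scale n the operator \<theta> acts as multiplication by u up to terms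
  of order 1/n, and C/n and D/n tend to 1/2, which gives the double root -1/2. The root u = 1 is
  simple, and this makes the coefficients of u converge one after the other.\<close>

lemma nn_integral_termwise:
  fixes f :: "nat \<Rightarrow> real \<Rightarrow> real"
  assumes [measurable]: "\<And>n. f n \<in> borel_measurable borel" "S \<in> sets borel"
    and nonneg: "\<And>n x. x \<in> S \<Longrightarrow> 0 \<le> f n x"
    and sums: "\<And>x. x \<in> S \<Longrightarrow> (\<lambda>n. f n x) sums F x"
    and int: "\<And>n. (\<integral>\<^sup>+x. ennreal (f n x) * indicator S x \<partial>lborel) = ennreal (I n)"
  shows "(\<integral>\<^sup>+x. ennreal (F x) * indicator S x \<partial>lborel) = (\<Sum>n. ennreal (I n))"
proof -
  have "(\<integral>\<^sup>+x. ennreal (F x) * indicator S x \<partial>lborel)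
      = (\<integral>\<^sup>+x. (\<Sum>n. ennreal (f n x) * indicator S x) \<partial>lborel)"
  proof (rule nn_integral_cong)
    fix x
    show "ennreal (F x) * indicator S x = (\<Sum>n. ennreal (f n x) * indicator S x)"
      using suminf_ennreal_eq[OF nonneg sums] by (cases "x \<in> S") simp_all
  qed
  also have "\<dots> = (\<Sum>n. \<integral>\<^sup>+x. ennreal (f n x) * indicator S x \<partial>lborel)"
    by (rule nn_integral_suminf) simp
  finally show ?thesis by (simp add: int)
qed

lemma Beta_real_pos: "p > 0 \<Longrightarrow> q > 0 \<Longrightarrow> Beta p q > (0::real)"
  by (simp add: Beta_def)

lemma nn_integral_beta:
  fixes p q :: real
  assumes "p > 0" "q > 0"
  shows "(\<integral>\<^sup>+x. ennreal (x powr (p - 1) * (1 - x) powr (q - 1)) * indicator {0<..<1} x \<partial>lborel)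
    = ennreal (Beta p q)"
proof -
  have "((\<lambda>t. t powr (p - 1) * (1 - t) powr (q - 1)) has_integral Beta p q) {0<..<1}"
    using has_integral_Beta_real[OF assms] by (simp add: has_integral_Icc_iff_Ioo)
  then show ?thesis
    by (rule nn_integral_has_integral_lebesgue'[rotated]) auto
qed

lemma nn_integral_beta_cmult:
  fixes p q r :: real
  assumes "p > 0" "q > 0" "r \<ge> 0"
  shows "(\<integral>\<^sup>+x. ennreal (r * (x powr (p - 1) * (1 - x) powr (q - 1))) * indicator {0<..<1} x \<partial>lborel)
    = ennreal (r * Beta p q)"
proof -
  have "ennreal (r * (x powr (p - 1) * (1 - x) powr (q - 1))) * indicator {0<..<1} x
      = ennreal r * (ennreal (x powr (p - 1) * (1 - x) powr (q - 1)) * indicator {0<..<1} x)" for x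
    using assms by (subst ennreal_mult) (auto simp: mult.assoc)
  moreover have "ennreal (r * Beta p q) = ennreal r * ennreal (Beta p q)"
    using assms Beta_real_pos[of p q] by (intro ennreal_mult) auto
  ultimately show ?thesis
    using assms by (simp add: nn_integral_cmult nn_integral_beta)
qed

lemma Beta_add_nat:
  fixes p q :: real
  assumes "p > 0" "q > 0"
  shows "Beta (p + real n) q = Beta p q * pochhammer p n / pochhammer (p + q) n"
proof -
  have "p \<notin> \<int>\<^sub>\<le>\<^sub>0" "p + q \<notin> \<int>\<^sub>\<le>\<^sub>0"
    using assms by (auto elim!: nonpos_Ints_cases)
  then have "pochhammer p n = Gamma (p + real n) / Gamma p"
    "pochhammer (p + q) n = Gamma (p + q + real n) / Gamma (p + q)"
    by (simp_all add: pochhammer_Gamma)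
  moreover have "Gamma p > 0" "Gamma (p + q) > 0" "Gamma (p + q + real n) > 0"
    using assms by (auto intro!: Gamma_real_pos)
  ultimately show ?thesis
    by (simp add: Beta_def field_simps)
qed

lemma one_minus_powr_series:
  fixes \<alpha> x :: real
  assumes "\<bar>x\<bar> < 1"
  shows "(\<lambda>n. pochhammer \<alpha> n / fact n * x ^ n) sums (1 - x) powr (-\<alpha>)"
proof -
  have "(\<lambda>n. ((-\<alpha>) gchoose n) * (-x) ^ n) sums (1 + - x) powr (-\<alpha>)"
    using assms by (intro gen_binomial_real) simp
  moreover have "((-\<alpha>) gchoose n) * (-x) ^ n = pochhammer \<alpha> n / fact n * x ^ n" for n
    by (simp add: gbinomial_pochhammer power_minus[of x])
  ultimately show ?thesis by simp
qed

text \<open>Integrate the binomial series of \<open>(1 - x) powr (-\<alpha>)\<close> against the beta density with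
  parameters \<open>\<beta>\<close> and \<open>\<gamma> - \<beta>\<close>.\<close>
lemma Gauss_summation:
  fixes \<alpha> \<beta> \<gamma> :: real
  assumes "\<alpha> > 0" "\<beta> > 0" "\<gamma> > \<alpha> + \<beta>"
  shows "(\<lambda>n. pochhammer \<alpha> n * pochhammer \<beta> n / (pochhammer \<gamma> n * fact n))
    sums (Beta \<beta> (\<gamma> - \<alpha> - \<beta>) / Beta \<beta> (\<gamma> - \<beta>))"
proof -
  define I where "I n = pochhammer \<alpha> n / fact n * Beta (\<beta> + real n) (\<gamma> - \<beta>)" for n
  define f where "f n x = pochhammer \<alpha> n / fact n *
    (x powr (\<beta> + real n - 1) * (1 - x) powr (\<gamma> - \<beta> - 1))" for n x
  have I: "I n = Beta \<beta> (\<gamma> - \<beta>) * (pochhammer \<alpha> n * pochhammer \<beta> n / (pochhammer \<gamma> n * fact n))" for n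
    using assms by (simp add: I_def Beta_add_nat mult_ac)
  have "(\<integral>\<^sup>+x. ennreal (x powr (\<beta> - 1) * (1 - x) powr (\<gamma> - \<alpha> - \<beta> - 1)) * indicator {0<..<1} x \<partial>lborel)
      = (\<Sum>n. ennreal (I n))"
  proof (rule nn_integral_termwise)
    show "f n \<in> borel_measurable borel" for n
      unfolding f_def by measurable
    show "f n x \<ge> 0" for n x
      using assms by (auto simp: f_def intro!: mult_nonneg_nonneg divide_nonneg_nonneg pochhammer_nonneg)
    show "(\<integral>\<^sup>+x. ennreal (f n x) * indicator {0<..<1} x \<partial>lborel) = ennreal (I n)" for n
      unfolding f_def I_def using assms
      by (intro nn_integral_beta_cmult) (auto intro!: divide_nonneg_nonneg pochhammer_nonneg)
    fix x :: real assume "x \<in> {0<..<1}"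
    then have x: "0 < x" "x < 1" by auto
    have "(\<lambda>n. (x powr (\<beta> - 1) * (1 - x) powr (\<gamma> - \<beta> - 1)) * (pochhammer \<alpha> n / fact n * x ^ n))
      sums ((x powr (\<beta> - 1) * (1 - x) powr (\<gamma> - \<beta> - 1)) * (1 - x) powr (-\<alpha>))"
      using x by (intro sums_mult one_minus_powr_series) simp
    moreover have "(x powr (\<beta> - 1) * (1 - x) powr (\<gamma> - \<beta> - 1)) * (1 - x) powr (-\<alpha>)
      = x powr (\<beta> - 1) * (1 - x) powr (\<gamma> - \<alpha> - \<beta> - 1)"
      using x by (simp add: mult.assoc algebra_simps flip: powr_add)
    moreover have "(x powr (\<beta> - 1) * (1 - x) powr (\<gamma> - \<beta> - 1)) * (pochhammer \<alpha> n / fact n * x ^ n) = f n x" for n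
    proof -
      have "x powr (\<beta> + real n - 1) = x powr (\<beta> - 1) * x ^ n"
        using x by (simp add: algebra_simps flip: powr_realpow powr_add)
      then show ?thesis by (simp add: f_def)
    qed
    ultimately show "(\<lambda>n. f n x) sums (x powr (\<beta> - 1) * (1 - x) powr (\<gamma> - \<alpha> - \<beta> - 1))"
      by simp
  qed simp
  moreover have "(\<integral>\<^sup>+x. ennreal (x powr (\<beta> - 1) * (1 - x) powr (\<gamma> - \<alpha> - \<beta> - 1)) * indicator {0<..<1} x \<partial>lborel)
    = ennreal (Beta \<beta> (\<gamma> - \<alpha> - \<beta>))"
    using assms by (intro nn_integral_beta) auto
  moreover have I0: "I n \<ge> 0" for n
    unfolding I_def using assms
    by (intro mult_nonneg_nonneg divide_nonneg_nonneg pochhammer_nonneg less_imp_le[OF Beta_real_pos]) auto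
  moreover have B: "Beta \<beta> (\<gamma> - \<alpha> - \<beta>) > 0" "Beta \<beta> (\<gamma> - \<beta>) > 0"
    using assms by (auto intro!: Beta_real_pos)
  \<comment> \<open>Every series converges in \<open>ennreal\<close>; since the Beta integral is
    finite, the identity descends to a convergent real series.\<close>
  ultimately have "(\<lambda>n. ennreal (I n)) sums ennreal (Beta \<beta> (\<gamma> - \<alpha> - \<beta>))"
    by (metis summable_sums summableI)
  then have "I sums Beta \<beta> (\<gamma> - \<alpha> - \<beta>)"
    using I0 B by simp
  then have "(\<lambda>n. I n / Beta \<beta> (\<gamma> - \<beta>)) sums (Beta \<beta> (\<gamma> - \<alpha> - \<beta>) / Beta \<beta> (\<gamma> - \<beta>))"
    by (rule sums_divide)
  then show ?thesis
    using B by (simp add: I)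
qed

lemma hyp2F1_sums:
  fixes \<alpha> \<beta> \<gamma> z :: real
  assumes "\<alpha> > 0" "\<beta> > 0" "\<gamma> > 0" "0 < z" "z < 1"
  shows "(\<lambda>n. pochhammer \<alpha> n * pochhammer \<beta> n / pochhammer \<gamma> n * (z ^ n / fact n)) sums hyp2F1 \<alpha> \<beta> \<gamma> z"
proof -
  define f where "f n = pochhammer \<alpha> n * pochhammer \<beta> n / pochhammer \<gamma> n * (z ^ n / fact n)" for n
  have pos: "f n > 0" for n
    using assms by (auto simp: f_def intro!: mult_pos_pos divide_pos_pos pochhammer_pos)
  have ratio: "f (Suc n) = (\<alpha> + n) * (\<beta> + n) / ((\<gamma> + n) * (1 + n)) * z * f n" for n
    by (simp add: f_def pochhammer_Suc mult_ac)
  have "(\<lambda>n. (\<alpha> + real n) * (\<beta> + real n) / ((\<gamma> + real n) * (1 + real n)) * z) \<longlonglongrightarrow> z"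
    by real_asymp
  \<comment> \<open>The ratio of consecutive terms tends to \<open>z\<close>; the midpoint between
    \<open>z\<close> and 1 serves as contraction factor.\<close>
  moreover have "z < (1 + z) / 2" using assms by simp
  ultimately have "eventually (\<lambda>n. (\<alpha> + real n) * (\<beta> + real n) / ((\<gamma> + real n) * (1 + real n)) * z < (1 + z) / 2) sequentially"
    by (rule order_tendstoD)
  then obtain N where N: "\<And>n. n \<ge> N \<Longrightarrow>
      (\<alpha> + real n) * (\<beta> + real n) / ((\<gamma> + real n) * (1 + real n)) * z < (1 + z) / 2"
    by (auto simp: eventually_sequentially)
  have "summable f"
  proof (rule summable_ratio_test)
    show "(1 + z) / 2 < 1" using assms by simp
    show "norm (f (Suc n)) \<le> (1 + z) / 2 * norm (f n)" if "n \<ge> N" for n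
    proof -
      have "f (Suc n) \<le> (1 + z) / 2 * f n"
        unfolding ratio using N[OF that] pos[of n] by (intro mult_right_mono) auto
      then show ?thesis using pos[of n] pos[of "Suc n"] by simp
    qed
  qed
  then show ?thesis
    unfolding hyp2F1_def f_def by (rule summable_sums)
qed

lemma measurable_weight_W [measurable]: "weight_W a b c d \<in> borel_measurable borel"
  unfolding weight_W_def hyp2F1_def Let_def by measurable

text \<open>Expanding the 2F1 in powers of \<open>1 - x\<close> leaves Beta integrals, whose sum is
  a 2F1 at 1 that Gauss' theorem evaluates. The hypotheses ask for \<open>c > b\<close> and
  \<open>d > b\<close>, which make all terms nonnegative, but not for \<open>c > a\<close>: the
  limit density has \<open>a = 2/3\<close> and \<open>c = 1/2\<close>.\<close>

lemma nn_integral_weight_W: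
  fixes a b c d :: real
  assumes "a > 0" "b > 0" "c > b" "d > b" "c + d > a + b"
  shows "(\<integral>\<^sup>+x. ennreal (x ^ k * weight_W a b c d x) * indicator {0<..<1} x \<partial>lborel)
    = ennreal (pochhammer a k * pochhammer b k / (pochhammer c k * pochhammer d k))"
proof -
  define \<delta> where "\<delta> = c + d - a - b"
  have \<delta>: "\<delta> > 0" using assms by (simp add: \<delta>_def)
  define K where "K = Gamma c * Gamma d / (Gamma a * Gamma b * Gamma \<delta>)"
  have G: "Gamma c > 0" "Gamma d > 0" "Gamma a > 0" "Gamma b > 0" "Gamma \<delta> > 0"
    using assms \<delta> by (auto intro!: Gamma_real_pos)
  then have K: "K > 0" by (simp add: K_def)
  define r where "r n = K * (pochhammer (c - b) n * pochhammer (d - b) n / (pochhammer \<delta> n * fact n))" for n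
  have r: "r n > 0" for n
    unfolding r_def using assms \<delta> K by (intro mult_pos_pos divide_pos_pos pochhammer_pos) auto
  define f where "f n x = r n * (x powr (a + real k - 1) * (1 - x) powr (\<delta> + real n - 1))" for n x
  define I where "I n = r n * Beta (a + real k) (\<delta> + real n)" for n
  have "(\<integral>\<^sup>+x. ennreal (x ^ k * weight_W a b c d x) * indicator {0<..<1} x \<partial>lborel)
      = (\<Sum>n. ennreal (I n))"
  proof (rule nn_integral_termwise)
    show "f n \<in> borel_measurable borel" for n
      unfolding f_def by measurable
    show "f n x \<ge> 0" for n x
      using r[of n] by (auto simp: f_def)
    show "(\<integral>\<^sup>+x. ennreal (f n x) * indicator {0<..<1} x \<partial>lborel) = ennreal (I n)" for n
      unfolding f_def I_def using assms \<delta> r[of n]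
      by (intro nn_integral_beta_cmult) auto
    fix x :: real assume "x \<in> {0<..<1}"
    then have x: "0 < x" "x < 1" by auto
    let ?K = "x ^ k * (K * x powr (a - 1) * (1 - x) powr (\<delta> - 1))"
    have "(\<lambda>n. ?K * (pochhammer (c - b) n * pochhammer (d - b) n / pochhammer \<delta> n * ((1 - x) ^ n / fact n)))
      sums (?K * hyp2F1 (c - b) (d - b) \<delta> (1 - x))"
      using x assms \<delta> by (intro sums_mult hyp2F1_sums) auto
    moreover have "?K * (pochhammer (c - b) n * pochhammer (d - b) n / pochhammer \<delta> n * ((1 - x) ^ n / fact n)) = f n x" for n
    proof -
      have "x powr (a + real k - 1) = x ^ k * x powr (a - 1)"
        using x by (simp add: algebra_simps flip: powr_realpow powr_add)
      moreover have "(1 - x) powr (\<delta> + real n - 1) = (1 - x) ^ n * (1 - x) powr (\<delta> - 1)"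
        using x by (simp add: algebra_simps flip: powr_realpow powr_add)
      ultimately show ?thesis by (simp add: f_def r_def)
    qed
    ultimately show "(\<lambda>n. f n x) sums (x ^ k * weight_W a b c d x)"
      by (simp add: weight_W_def Let_def K_def \<delta>_def mult_ac)
  qed simp
  also have "(\<Sum>n. ennreal (I n)) = ennreal (pochhammer a k * pochhammer b k / (pochhammer c k * pochhammer d k))"
  proof (rule suminf_ennreal_eq)
    show "I n \<ge> 0" for n
      unfolding I_def using assms \<delta> r[of n]
      by (intro mult_nonneg_nonneg less_imp_le[OF Beta_real_pos]) auto
    \<comment> \<open>The factor \<open>x ^ k\<close> only raises \<open>a\<close> to
      \<open>a + k\<close>. Integration then replaces the lower parameter \<delta> of the series by
      \<gamma>, for which Gauss' excess \<gamma> - (c - b) - (d - b) equals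
      \<open>b + k\<close>.\<close>
    define \<gamma> where "\<gamma> = a + real k + \<delta>"
    have \<gamma>: "\<gamma> > 0" using assms \<delta> by (simp add: \<gamma>_def)
    have "(\<lambda>n. pochhammer (c - b) n * pochhammer (d - b) n / (pochhammer \<gamma> n * fact n))
        sums (Beta (d - b) (\<gamma> - (c - b) - (d - b)) / Beta (d - b) (\<gamma> - (d - b)))"
      using assms by (intro Gauss_summation) (auto simp: \<gamma>_def \<delta>_def)
    then have "(\<lambda>n. K * Beta (a + real k) \<delta> * (pochhammer (c - b) n * pochhammer (d - b) n / (pochhammer \<gamma> n * fact n)))
        sums (K * Beta (a + real k) \<delta> * (Beta (d - b) (\<gamma> - (c - b) - (d - b)) / Beta (d - b) (\<gamma> - (d - b))))"
      by (rule sums_mult)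
    moreover have "I = (\<lambda>n. K * Beta (a + real k) \<delta> * (pochhammer (c - b) n * pochhammer (d - b) n / (pochhammer \<gamma> n * fact n)))"
    proof
      fix n
      have "Beta (a + real k) (\<delta> + real n) = Beta (a + real k) \<delta> * pochhammer \<delta> n / pochhammer \<gamma> n"
        using assms \<delta> Beta_add_nat[of \<delta> "a + real k" n]
        by (simp add: \<gamma>_def Beta_commute add_ac)
      moreover have "pochhammer \<delta> n > 0" using \<delta> by (rule pochhammer_pos)
      ultimately show "I n = K * Beta (a + real k) \<delta> * (pochhammer (c - b) n * pochhammer (d - b) n / (pochhammer \<gamma> n * fact n))"
        by (simp add: I_def r_def mult_ac)
    qed
    moreover have "K * Beta (a + real k) \<delta> * (Beta (d - b) (\<gamma> - (c - b) - (d - b)) / Beta (d - b) (\<gamma> - (d - b)))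
       = pochhammer a k * pochhammer b k / (pochhammer c k * pochhammer d k)"
    proof -
      have eqs: "\<gamma> - (c - b) - (d - b) = b + real k" "\<gamma> - (d - b) = c + real k"
        "d - b + (b + real k) = d + real k" "d - b + (c + real k) = \<gamma>"
        by (auto simp: \<gamma>_def \<delta>_def)
      have G': "Gamma \<gamma> > 0" "Gamma (d - b) > 0" "Gamma (c + real k) > 0" "Gamma (d + real k) > 0"
        using assms \<gamma> by (auto intro!: Gamma_real_pos)
      have "a \<notin> \<int>\<^sub>\<le>\<^sub>0" "b \<notin> \<int>\<^sub>\<le>\<^sub>0" "c \<notin> \<int>\<^sub>\<le>\<^sub>0" "d \<notin> \<int>\<^sub>\<le>\<^sub>0"
        using assms by (auto elim!: nonpos_Ints_cases)
      then show ?thesis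
        using G G' by (simp add: eqs Beta_def pochhammer_Gamma K_def mult_ac flip: \<gamma>_def)
    qed
    ultimately show "I sums (pochhammer a k * pochhammer b k / (pochhammer c k * pochhammer d k))"
      by (simp only:)
  qed
  finally show ?thesis .
qed

lemma weight_W_nonneg:
  fixes a b c d :: real
  assumes "a > 0" "b > 0" "c > b" "d > b" "c + d > a + b" "0 < x" "x < 1"
  shows "weight_W a b c d x \<ge> 0"
proof -
  have "hyp2F1 (c - b) (d - b) (c + d - a - b) (1 - x) \<ge> 0"
    by (rule sums_le[OF _ sums_zero hyp2F1_sums])
      (use assms in \<open>auto intro!: mult_nonneg_nonneg divide_nonneg_nonneg pochhammer_nonneg\<close>)
  then show ?thesis
    using assms unfolding weight_W_def Let_def
    by (intro mult_nonneg_nonneg divide_nonneg_nonneg) (auto intro!: less_imp_le[OF Gamma_real_pos])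
qed

lemma has_bochner_integral_weight_W:
  fixes a b c d :: real
  assumes "a > 0" "b > 0" "c > b" "d > b" "c + d > a + b"
  shows "has_bochner_integral lborel (\<lambda>x. indicator {0<..<1} x *\<^sub>R (x ^ k * weight_W a b c d x))
    (pochhammer a k * pochhammer b k / (pochhammer c k * pochhammer d k))"
proof (rule has_bochner_integral_nn_integral)
  show "AE x in lborel. 0 \<le> indicator {0<..<1} x *\<^sub>R (x ^ k * weight_W a b c d x)"
    using weight_W_nonneg[OF assms] by (intro AE_I2) (auto simp: indicator_def)
  show "0 \<le> pochhammer a k * pochhammer b k / (pochhammer c k * pochhammer d k)"
    using assms by (intro divide_nonneg_nonneg mult_nonneg_nonneg pochhammer_nonneg) auto
  show "(\<integral>\<^sup>+x. ennreal (indicator {0<..<1} x *\<^sub>R (x ^ k * weight_W a b c d x)) \<partial>lborel)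
      = ennreal (pochhammer a k * pochhammer b k / (pochhammer c k * pochhammer d k))"
    unfolding nn_integral_weight_W[OF assms, symmetric]
    by (intro nn_integral_cong) (auto simp: indicator_def)
qed simp

text \<open>Coefficientwise this is (\<beta>)_n - n (\<beta>)_(n-1) = (\<beta> - 1)_n. Here \<beta>
  - 1 may be negative, outside the reach of \<open>hyp2F1_sums\<close>; convergence of that series
  comes from the two on the right.\<close>

lemma hyp2F1_contiguous:
  fixes \<alpha> \<beta> \<gamma> z :: real
  assumes "\<alpha> > 0" "\<beta> > 0" "\<gamma> > 0" "0 < z" "z < 1"
  shows "hyp2F1 \<alpha> (\<beta> - 1) \<gamma> z = hyp2F1 \<alpha> \<beta> \<gamma> z - \<alpha> / \<gamma> * z * hyp2F1 (\<alpha> + 1) \<beta> (\<gamma> + 1) z"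
proof -
  define g where "g n = (if n = 0 then 0 else
    pochhammer \<alpha> n * pochhammer \<beta> (n - 1) / pochhammer \<gamma> n * (z ^ n / fact (n - 1)))" for n
  have g0: "g 0 = 0" by (simp add: g_def)
  have "(\<lambda>n. \<alpha> / \<gamma> * z * (pochhammer (\<alpha> + 1) n * pochhammer \<beta> n / pochhammer (\<gamma> + 1) n * (z ^ n / fact n)))
      sums (\<alpha> / \<gamma> * z * hyp2F1 (\<alpha> + 1) \<beta> (\<gamma> + 1) z)"
    using assms by (intro sums_mult hyp2F1_sums) auto
  moreover have "\<alpha> / \<gamma> * z * (pochhammer (\<alpha> + 1) n * pochhammer \<beta> n / pochhammer (\<gamma> + 1) n * (z ^ n / fact n))
      = g (Suc n)" for n
    by (simp add: g_def pochhammer_rec mult_ac)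
  ultimately have "(\<lambda>n. g (Suc n)) sums (\<alpha> / \<gamma> * z * hyp2F1 (\<alpha> + 1) \<beta> (\<gamma> + 1) z)"
    by simp
  then have "g sums (\<alpha> / \<gamma> * z * hyp2F1 (\<alpha> + 1) \<beta> (\<gamma> + 1) z)"
    by (auto dest: sums_Suc simp: g0)
  then have "(\<lambda>n. pochhammer \<alpha> n * pochhammer \<beta> n / pochhammer \<gamma> n * (z ^ n / fact n) - g n)
      sums (hyp2F1 \<alpha> \<beta> \<gamma> z - \<alpha> / \<gamma> * z * hyp2F1 (\<alpha> + 1) \<beta> (\<gamma> + 1) z)"
    using assms by (intro sums_diff hyp2F1_sums) auto
  moreover have "pochhammer \<alpha> n * pochhammer \<beta> n / pochhammer \<gamma> n * (z ^ n / fact n) - g n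
      = pochhammer \<alpha> n * pochhammer (\<beta> - 1) n / pochhammer \<gamma> n * (z ^ n / fact n)" for n
  proof (cases n)
    case (Suc m)
    have "pochhammer \<beta> n = pochhammer \<beta> m * (\<beta> + m)"
      by (simp add: Suc pochhammer_Suc)
    moreover have "g n = pochhammer \<alpha> n * (pochhammer \<beta> m * (m + 1)) / pochhammer \<gamma> n * (z ^ n / fact n)"
      by (simp add: g_def Suc mult_ac add_ac)
    ultimately have "pochhammer \<alpha> n * pochhammer \<beta> n / pochhammer \<gamma> n * (z ^ n / fact n) - g n
        = (pochhammer \<beta> m * (\<beta> + m) - pochhammer \<beta> m * (m + 1)) * (pochhammer \<alpha> n / pochhammer \<gamma> n * (z ^ n / fact n))"
      by (simp add: algebra_simps add_divide_distrib diff_divide_distrib)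
    also have "pochhammer \<beta> m * (\<beta> + m) - pochhammer \<beta> m * (m + 1) = pochhammer (\<beta> - 1) n"
      using pochhammer_rec[of "\<beta> - 1" m] by (simp add: Suc algebra_simps)
    finally show ?thesis by (simp add: mult_ac)
  qed (simp add: g_def)
  ultimately show ?thesis
    unfolding hyp2F1_def by (simp add: sums_iff)
qed

text \<open>The left side is the second component of the weight vector, with
  \<open>d - (b + 1)\<close> of arbitrary sign. Both weights on the right satisfy the hypotheses of
  the moment formula, so integrability and moments carry over by subtraction.\<close>

lemma weight_W_contiguous:
  fixes a b c d x :: real
  assumes "a > 0" "b > 0" "c > b" "d > b" "c + d > a + b" "0 < x" "x < 1"
  shows "weight_W a (b + 1) (c + 1) d x
    = c / b * weight_W a b c d x - (c - b) / b * weight_W a b (c + 1) d x"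
proof -
  define \<delta> where "\<delta> = c + d - a - b"
  have \<delta>: "\<delta> > 0" using assms by (simp add: \<delta>_def)
  define X where "X = x powr (a - 1) * (1 - x) powr (\<delta> - 1)"
  define K where "K = Gamma c * Gamma d / (Gamma a * Gamma b * Gamma \<delta>)"
  have pos: "Gamma a > 0" "Gamma b > 0" "Gamma \<delta> > 0"
    using assms \<delta> by (auto intro!: Gamma_real_pos)
  have G: "Gamma (c + 1) = c * Gamma c" "Gamma (b + 1) = b * Gamma b" "Gamma (\<delta> + 1) = \<delta> * Gamma \<delta>"
    using assms \<delta> by (auto intro!: Gamma_plus1 elim!: nonpos_Ints_cases)
  have e: "c + 1 + d - a - (b + 1) = \<delta>" "c + 1 + d - a - b = \<delta> + 1" "c + d - a - b = \<delta>"
    "c + 1 - (b + 1) = c - b" "d - (b + 1) = (d - b) - 1" "c + 1 - b = (c - b) + 1"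
    by (simp_all add: \<delta>_def)
  have p: "(1 - x) powr \<delta> = (1 - x) * (1 - x) powr (\<delta> - 1)"
    using assms by (simp add: powr_diff)
  have "weight_W a (b + 1) (c + 1) d x = c / b * K * X * hyp2F1 (c - b) (d - b - 1) \<delta> (1 - x)"
    unfolding weight_W_def Let_def e G X_def K_def by (simp add: mult_ac)
  also have "hyp2F1 (c - b) (d - b - 1) \<delta> (1 - x) = hyp2F1 (c - b) (d - b) \<delta> (1 - x)
      - (c - b) / \<delta> * (1 - x) * hyp2F1 (c - b + 1) (d - b) (\<delta> + 1) (1 - x)"
    using assms \<delta> by (intro hyp2F1_contiguous) auto
  finally have 1: "weight_W a (b + 1) (c + 1) d x = c / b * K * X * (hyp2F1 (c - b) (d - b) \<delta> (1 - x)
      - (c - b) / \<delta> * (1 - x) * hyp2F1 (c - b + 1) (d - b) (\<delta> + 1) (1 - x))" .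
  have 2: "weight_W a b c d x = K * X * hyp2F1 (c - b) (d - b) \<delta> (1 - x)"
    unfolding weight_W_def Let_def e G X_def K_def by (simp add: mult_ac)
  have 3: "weight_W a b (c + 1) d x = c / \<delta> * K * (X * (1 - x)) * hyp2F1 (c - b + 1) (d - b) (\<delta> + 1) (1 - x)"
    unfolding weight_W_def Let_def e G X_def K_def using p by (simp add: mult_ac)
  have "c / b * K * X * (F - e / \<delta> * y * G) = c / b * (K * X * F) - e / b * (c / \<delta> * K * (X * y) * G)" for e y F G
    by (simp add: right_diff_distrib mult_ac)
  then show ?thesis
    unfolding 1 2 3 by blast
qed

definition moment_W :: "real \<Rightarrow> real \<Rightarrow> real \<Rightarrow> real \<Rightarrow> nat \<Rightarrow> real" where
  "moment_W a b c d k = pochhammer a k * pochhammer b k / (pochhammer c k * pochhammer d k)"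

lemma pochhammer_shift:
  fixes x :: real
  shows "x > 0 \<Longrightarrow> pochhammer (x + 1) k = pochhammer x k * (x + k) / x"
  using pochhammer_rec[of x k] pochhammer_Suc[of x k] by (simp add: field_simps)

lemma has_bochner_integral_weight_vec:
  fixes a b c d :: real
  assumes "a > 0" "b > 0" "c > b" "d > b" "c + d > a + b"
  shows "has_bochner_integral lborel (\<lambda>x. indicator {0<..<1} x *\<^sub>R (x ^ k * weight_vec a b c d j x))
    (if j = 0 then moment_W a b c d k else moment_W a (b + 1) (c + 1) d k)"
proof (cases "j = 0")
  case True
  then show ?thesis
    using has_bochner_integral_weight_W[OF assms] by (simp add: weight_vec_def moment_W_def)
next
  case False
  have "has_bochner_integral lborel
    (\<lambda>x. c / b * (indicator {0<..<1} x *\<^sub>R (x ^ k * weight_W a b c d x))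
       - (c - b) / b * (indicator {0<..<1} x *\<^sub>R (x ^ k * weight_W a b (c + 1) d x)))
    (c / b * moment_W a b c d k - (c - b) / b * moment_W a b (c + 1) d k)"
    unfolding moment_W_def using assms
    by (intro has_bochner_integral_diff has_bochner_integral_mult_right has_bochner_integral_weight_W) auto
  moreover have "c / b * (indicator {0<..<1} x *\<^sub>R (x ^ k * weight_W a b c d x))
       - (c - b) / b * (indicator {0<..<1} x *\<^sub>R (x ^ k * weight_W a b (c + 1) d x))
     = indicator {0<..<1} x *\<^sub>R (x ^ k * weight_W a (b + 1) (c + 1) d x)" for x
    using weight_W_contiguous[OF assms, of x] by (auto simp: indicator_def right_diff_distrib mult_ac)
  moreover have "c / b * moment_W a b c d k - (c - b) / b * moment_W a b (c + 1) d k
      = moment_W a (b + 1) (c + 1) d k"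
  proof -
    have "pochhammer c k > 0" "pochhammer d k > 0" using assms by (auto intro!: pochhammer_pos)
    then show ?thesis
      using assms by (simp add: moment_W_def pochhammer_shift divide_simps) (simp add: algebra_simps)
  qed
  ultimately show ?thesis
    using False by (simp add: weight_vec_def)
qed

section \<open>The limit density as a member of the same family of weights\<close>

lemma Gamma_third: "Gamma (1 / 3) * Gamma (2 / 3 :: real) = 2 * pi / sqrt 3"
proof -
  have "complex_of_real (Gamma (1 / 3) * Gamma (2 / 3)) = Gamma (1 / 3) * Gamma (1 - 1 / 3)"
    by (simp flip: Gamma_complex_of_real)
  also have "\<dots> = of_real pi / sin (of_real pi * (1 / 3))"
    by (rule Gamma_reflection_complex)
  also have "of_real pi * (1 / 3) = complex_of_real (pi / 3)" by simp
  also have "sin (complex_of_real (pi / 3)) = complex_of_real (sqrt 3 / 2)"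
    unfolding sin_of_real sin_60 ..
  finally have "complex_of_real (Gamma (1 / 3) * Gamma (2 / 3)) = complex_of_real (pi / (sqrt 3 / 2))"
    by simp
  then show ?thesis
    unfolding of_real_eq_iff by simp
qed

text \<open>The even part of the binomial series of \<open>(1 - t) powr (-1/3)\<close>.\<close>
lemma hyp2F1_even_binomial:
  fixes t :: real
  assumes "0 < t" "t < 1"
  shows "hyp2F1 (1/6) (2/3) (1/2) (t\<^sup>2) = ((1 + t) powr (-1/3) + (1 - t) powr (-1/3)) / 2"
proof -
  define f where "f n = (pochhammer (1/3) n / fact n * (-t) ^ n + pochhammer (1/3) n / fact n * t ^ n) / 2" for n
  have "f sums (((1 - (-t)) powr (-(1/3)) + (1 - t) powr (-(1/3))) / 2)"
    unfolding f_def using assms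
    by (intro sums_divide sums_add one_minus_powr_series) auto
  then have "(\<lambda>n. f (2 * n)) sums (((1 - (-t)) powr (-(1/3)) + (1 - t) powr (-(1/3))) / 2)"
  proof (subst sums_mono_reindex)
    show "f n = 0" if "n \<notin> range (\<lambda>n. 2 * n)" for n
    proof -
      have "odd n" using that by (auto elim: evenE)
      then show ?thesis by (simp add: f_def)
    qed
  qed (auto simp: strict_mono_def)
  moreover have "f (2 * n) = pochhammer (1/6) n * pochhammer (2/3) n / pochhammer (1/2) n * ((t\<^sup>2) ^ n / fact n)" for n
  proof -
    \<comment> \<open>The duplication formula applied to (1/3)_(2n) and to (2n)! = (1)_(2n) produces
      the parameters 1/6, 2/3 and 1/2.\<close>
    have "pochhammer (1/3) (2 * n) = 2 ^ (2 * n) * pochhammer (1/6) n * pochhammer (2/3 :: real) n"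
      using pochhammer_double[of "1/6 :: real" n] by simp
    moreover have "fact (2 * n) = 2 ^ (2 * n) * pochhammer (1/2) n * (fact n :: real)"
      using pochhammer_double[of "1/2 :: real" n] by (simp add: pochhammer_fact)
    moreover have "f (2 * n) = pochhammer (1/3) (2 * n) / fact (2 * n) * (t\<^sup>2) ^ n"
      by (simp add: f_def power_mult)
    ultimately show ?thesis
      by (simp add: mult_ac)
  qed
  ultimately show ?thesis
    by (simp add: hyp2F1_def sums_iff)
qed

text \<open>With t = sqrt (1 - x) one has x = (1 - t)(1 + t). The factor x powr (-1/3) therefore
  turns the power -1/3 of 1 + t into the power 1/3 of 1 - t over x powr (2/3), and conversely, so
  the two summands of the even binomial series are exchanged.\<close>

lemma limit_density_eq_weight_W:
  assumes "0 < x" "x < 1"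
  shows "limit_density x = weight_W (2/3) (1/3) (1/2) 1 x"
proof -
  define t where "t = sqrt (1 - x)"
  have t: "0 < t" "t < 1" "t\<^sup>2 = 1 - x" using assms by (auto simp: t_def)
  have x: "x = (1 - t) * (1 + t)" using t(3) by (simp add: power2_eq_square algebra_simps)
  have p: "(1 - x) powr (-1/2) = 1 / t"
    using assms powr_minus_divide[of "1 - x" "1/2"] by (simp add: t_def powr_half_sqrt)
  have m: "x powr (-1/3) * (1 + t) powr (-1/3) = (1 - t) powr (1/3) / x powr (2/3)"
    "x powr (-1/3) * (1 - t) powr (-1/3) = (1 + t) powr (1/3) / x powr (2/3)"
  proof -
    have "x powr (-1/3) = x powr (1/3) / x powr (2/3)"
      using assms by (simp flip: powr_diff)
    moreover have "x powr (1/3) = (1 - t) powr (1/3) * (1 + t) powr (1/3)"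
      using t unfolding x by (subst powr_mult) auto
    moreover have "(1 + t) powr (-1/3) = 1 / (1 + t) powr (1/3)" "(1 - t) powr (-1/3) = 1 / (1 - t) powr (1/3)"
      using powr_minus_divide[of "1 + t" "1/3"] powr_minus_divide[of "1 - t" "1/3"] by simp_all
    ultimately show "x powr (-1/3) * (1 + t) powr (-1/3) = (1 - t) powr (1/3) / x powr (2/3)"
      "x powr (-1/3) * (1 - t) powr (-1/3) = (1 + t) powr (1/3) / x powr (2/3)"
      using t by simp_all
  qed
  have K: "Gamma (1/2) * Gamma 1 / (Gamma (2/3) * Gamma (1/3) * Gamma (1/2)) = sqrt 3 / (2 * pi)"
  proof -
    have "Gamma (1/2 :: real) \<noteq> 0" using less_imp_neq[OF Gamma_real_pos[of "1/2"]] by simp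
    then have "Gamma (1/2) * Gamma 1 / (Gamma (2/3) * Gamma (1/3) * Gamma (1/2)) = 1 / (Gamma (1/3) * Gamma (2/3 :: real))"
      by simp
    then show ?thesis unfolding Gamma_third by simp
  qed
  have "weight_W (2/3) (1/3) (1/2) 1 x = Gamma (1/2) * Gamma 1 / (Gamma (2/3) * Gamma (1/3) * Gamma (1/2))
      * x powr (-1/3) * (1 - x) powr (-1/2) * hyp2F1 (1/6) (2/3) (1/2) (1 - x)"
    by (simp add: weight_W_def Let_def)
  also have "\<dots> = sqrt 3 / (2 * pi) * x powr (-1/3) * (1 / t) * (((1 + t) powr (-1/3) + (1 - t) powr (-1/3)) / 2)"
    unfolding K p hyp2F1_even_binomial[OF t(1,2), unfolded t(3)] ..
  also have "\<dots> = sqrt 3 / (4 * pi) / t * (x powr (-1/3) * (1 + t) powr (-1/3) + x powr (-1/3) * (1 - t) powr (-1/3))"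
    by (simp add: field_simps)
  also have "\<dots> = limit_density x"
    unfolding m using assms by (simp add: limit_density_def field_simps flip: t_def)
  finally show ?thesis ..
qed

section \<open>Contiguous relations and zeros\<close>

text \<open>The monic multiple of \<open>\<^sub>3F\<^sub>2(-n, C, D; a, b; x)\<close>.\<close>
definition hyp_poly :: "nat \<Rightarrow> real \<Rightarrow> real \<Rightarrow> real \<Rightarrow> real \<Rightarrow> real poly" where
  "hyp_poly n a b C D = (\<Sum>j\<le>n. monom ((-1) ^ (n - j) * real (n choose j)
     * (pochhammer (a + j) (n - j) * pochhammer (b + j) (n - j))
     / (pochhammer (C + j) (n - j) * pochhammer (D + j) (n - j))) j)"

lemma coeff_hyp_poly:
  "coeff (hyp_poly n a b C D) j = (-1) ^ (n - j) * real (n choose j)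
     * (pochhammer (a + j) (n - j) * pochhammer (b + j) (n - j))
     / (pochhammer (C + j) (n - j) * pochhammer (D + j) (n - j))"
  by (cases "j \<le> n") (simp_all add: hyp_poly_def coeff_sum)

lemma hyp_poly_0 [simp]: "hyp_poly 0 a b C D = 1"
  by (simp add: hyp_poly_def)

lemma hyp_poly_commute: "hyp_poly n a b C D = hyp_poly n a b D C" "hyp_poly n a b C D = hyp_poly n b a C D"
  by (simp_all add: hyp_poly_def mult_ac)

lemma lead_coeff_hyp_poly: "degree (hyp_poly n a b C D) = n" "lead_coeff (hyp_poly n a b C D) = 1"
proof -
  show "degree (hyp_poly n a b C D) = n"
    by (intro antisym degree_le le_degree) (auto simp: coeff_hyp_poly)
  then show "lead_coeff (hyp_poly n a b C D) = 1"
    by (simp add: coeff_hyp_poly)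
qed

lemma mult_diff_frac:
  fixes q x y d :: real
  shows "d \<noteq> 0 \<Longrightarrow> q * x - q * (y / d) = q * ((x * d - y) / d)"
  by (simp add: field_simps)

text \<open>The \<open>j\<close>-th coefficients of all three polynomials are multiples of one
  quantity \<open>Q\<close>. What remains is the linear identity \<open>key\<close>, whose factor
  \<open>m + 1\<close> cancels the denominator from the binomial coefficient, so that the multiplier
  does not depend on \<open>j\<close>. It is positive when \<open>D > b\<close> and
  \<open>a > 0\<close>.\<close>

lemma hyp_poly_shift:
  assumes "C > 0" "D > 0"
  shows "hyp_poly (Suc n) a b C D = hyp_poly (Suc n) a (b + 1) C (D + 1)
    + smult (real (Suc n) * (D - b) * (a + n) / ((C + n) * (D + n) * (D + n + 1))) (hyp_poly n a (b + 1) C D)"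
proof (rule poly_eqI)
  fix j
  consider "j > Suc n" | "j = Suc n" | "j \<le> n" by linarith
  then show "coeff (hyp_poly (Suc n) a b C D) j = coeff (hyp_poly (Suc n) a (b + 1) C (D + 1)
    + smult (real (Suc n) * (D - b) * (a + n) / ((C + n) * (D + n) * (D + n + 1))) (hyp_poly n a (b + 1) C D)) j"
  proof cases
    case 3
    define m where "m = n - j"
    have m: "n - j = m" "Suc n - j = Suc m" "n = m + j" using 3 by (auto simp: m_def)
    have "Suc m * (Suc n choose j) = Suc n * (n choose j)"
      using binomial_absorb_comp[of "Suc n" j] by (simp add: m)
    then have ch: "real (Suc n choose j) = (m + j + 1) * real (n choose j) / (m + 1)"
      by (simp add: m(3) field_simps flip: of_nat_mult of_nat_Suc)
    have pos: "pochhammer (C + j) m > 0" "pochhammer (D + j) m > 0"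
      using assms by (auto intro!: pochhammer_pos)
    have D: "pochhammer (D + 1 + j) (Suc m) = pochhammer (D + j) m * (D + j + m) * (D + j + m + 1) / (D + j)"
      using pochhammer_shift[of "D + j" "Suc m"] assms by (simp add: pochhammer_Suc add_ac)
    have b: "pochhammer (b + j) (Suc m) = (b + j) * pochhammer (b + 1 + j) m"
      by (simp add: pochhammer_rec add_ac)
    have key: "(b + j) * (D + n + 1) - (b + n + 1) * (D + j) = - ((m + 1) * (D - b))"
      by (simp add: m(3) algebra_simps)
    define Q where "Q = (-1) ^ m * real (n choose j) * pochhammer (a + j) m * (a + n)
      * pochhammer (b + 1 + j) m / (pochhammer (C + j) m * (C + n) * pochhammer (D + j) m * (D + n))"
    have nz: "C + n > 0" "D + n > 0" "D + n + 1 > 0" "D + j > 0" "real m + 1 > 0"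
      using assms by (auto intro!: add_pos_nonneg)
    have 1: "coeff (hyp_poly (Suc n) a b C D) j = - Q * (n + 1) / (m + 1) * (b + j)"
      using pos nz unfolding coeff_hyp_poly m(2) ch b Q_def by (simp add: pochhammer_Suc m(3) add_ac mult_ac)
    have 2: "coeff (hyp_poly (Suc n) a (b + 1) C (D + 1)) j = - Q * (n + 1) / (m + 1) * ((b + n + 1) * (D + j) / (D + n + 1))"
      using pos nz unfolding coeff_hyp_poly m(2) ch D Q_def
      by (simp add: pochhammer_Suc m(3) add_ac mult_ac)
    have 3: "coeff (hyp_poly n a (b + 1) C D) j * ((a + n) / ((C + n) * (D + n))) = Q"
      using pos nz unfolding coeff_hyp_poly m(1) Q_def by (simp add: mult_ac)
    have "coeff (hyp_poly (Suc n) a b C D) j - coeff (hyp_poly (Suc n) a (b + 1) C (D + 1)) j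
        = - Q * (n + 1) / (m + 1) * (((b + j) * (D + n + 1) - (b + n + 1) * (D + j)) / (D + n + 1))"
      unfolding 1 2 using nz by (intro mult_diff_frac) simp
    also have "\<dots> = Q * (n + 1) * (D - b) / (D + n + 1)"
      unfolding key using nz(5) by simp
    also have "\<dots> = (real (Suc n) * (D - b) * (a + n) / ((C + n) * (D + n) * (D + n + 1))) * coeff (hyp_poly n a (b + 1) C D) j"
      unfolding 3[symmetric] by (simp add: mult_ac add_ac)
    finally show ?thesis by simp
  qed (simp_all add: coeff_hyp_poly)
qed

text \<open>The mechanism is that of \<open>hyp_poly_shift\<close>. For \<open>n = 0\<close> the
  quotient (D - 1)/(D + n - 1) of the general multiplier is replaced by its cancelled value 1,
  because then \<open>D\<close> may be 1 or smaller.\<close>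

lemma hyp_poly_mult_X:
  assumes "C > 0" "D > 1 \<or> n = 0 \<and> D > 0"
  shows "[:0, 1:] * hyp_poly n (a + 1) (b + 1) (C + 1) D = hyp_poly (Suc n) a b C D
    + smult (if n = 0 then a * b / (C * D) else (a + n) * (b + n) * (D - 1) / ((C + n) * (D + n - 1) * (D + n)))
        (hyp_poly n a b C (D - 1))"
proof (cases "n = 0")
  case True
  show ?thesis
  proof (rule poly_eqI)
    fix j show "coeff ([:0, 1:] * hyp_poly n (a + 1) (b + 1) (C + 1) D) j = coeff (hyp_poly (Suc n) a b C D
      + smult (if n = 0 then a * b / (C * D) else (a + n) * (b + n) * (D - 1) / ((C + n) * (D + n - 1) * (D + n)))
        (hyp_poly n a b C (D - 1))) j"
      using True by (auto simp: coeff_hyp_poly coeff_pCons split: nat.splits)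
  qed
next
  case False
  then have D: "D > 1" using assms by auto
  show ?thesis
  proof (rule poly_eqI)
    fix j
    let ?g = "(a + n) * (b + n) * (D - 1) / ((C + n) * (D + n - 1) * (D + n))"
    have "coeff ([:0, 1:] * hyp_poly n (a + 1) (b + 1) (C + 1) D) j = coeff (hyp_poly (Suc n) a b C D) j
       + ?g * coeff (hyp_poly n a b C (D - 1)) j"
    proof -
      consider "j > Suc n" | "j = Suc n" | "j = 0" | i where "j = Suc i" "j \<le> n"
        by (cases j) (auto, linarith)
      then show ?thesis
      proof cases
        case 3
        have pos: "pochhammer C n > 0" "pochhammer (D - 1) n > 0" "C + n > 0" "D + n - 1 > 0" "D + n > 0"
          using assms D by (auto intro!: pochhammer_pos add_pos_nonneg)
        have "pochhammer D (Suc n) = pochhammer (D - 1) n * (D + n - 1) * (D + n) / (D - 1)"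
          using pochhammer_shift[of "D - 1" "Suc n"] D by (simp add: pochhammer_Suc algebra_simps)
        then show ?thesis
          using pos D unfolding 3 coeff_hyp_poly by (simp add: pochhammer_Suc[of a] pochhammer_Suc[of b] pochhammer_Suc[of C] add_ac mult_ac)
      next
        case (4 i)
        define m where "m = n - j"
        have m: "n - j = m" "Suc n - j = Suc m" "n - i = Suc m" "n = m + i + 1" using 4 by (auto simp: m_def)
        define K where "K = real (n choose j)"
        have "Suc m * (n choose i) = Suc i * (n choose Suc i)"
          using binomial_absorb_comp[of n i] binomial_absorption[of i n] m by simp
        then have ch: "real (n choose i) = (i + 1) * K / (m + 1)"
          unfolding K_def 4 by (simp add: field_simps flip: of_nat_mult of_nat_Suc)
        have ch': "real (Suc n choose j) = (n + 1) * K / (m + 1)"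
          using ch by (simp add: 4 K_def m(4) field_simps)
        have pos: "pochhammer (C + j) m > 0" "pochhammer (D + i) m > 0"
          using assms D by (auto intro!: pochhammer_pos add_pos_nonneg)
        have nz: "C + n > 0" "D + n - 1 > 0" "D + n > 0" "D + i > 0" "real m + 1 > 0"
          using assms D by (auto intro!: add_pos_nonneg)
        have Dj: "pochhammer (D + j) (Suc m) = pochhammer (D + i) m * (D + n - 1) * (D + n) / (D + i)"
          using pochhammer_shift[of "D + i" "Suc m"] nz by (simp add: 4 m(4) pochhammer_Suc add_ac)
        define Q where "Q = (-1) ^ m * pochhammer (a + j) m * pochhammer (b + j) m * (a + n) * (b + n)
          * K / (pochhammer (C + j) m * pochhammer (D + i) m * (C + n) * (D + n - 1))"
        have 1: "coeff ([:0, 1:] * hyp_poly n (a + 1) (b + 1) (C + 1) D) j = - Q / (m + 1) * (i + 1)"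
        proof -
          have "coeff ([:0, 1:] * hyp_poly n (a + 1) (b + 1) (C + 1) D) j = coeff (hyp_poly n (a + 1) (b + 1) (C + 1) D) i"
            by (simp add: 4)
          then show ?thesis
            using pos nz unfolding coeff_hyp_poly m(3) ch Q_def
            by (simp add: pochhammer_Suc 4 m(4) add_ac mult_ac)
        qed
        have 2: "coeff (hyp_poly (Suc n) a b C D) j = - Q / (m + 1) * ((n + 1) * (D + i) / (D + n))"
          using pos nz unfolding coeff_hyp_poly m(2) ch' Dj Q_def
          by (simp add: pochhammer_Suc 4 m(4) add_ac mult_ac)
        have 3: "coeff (hyp_poly n a b C (D - 1)) j * ((a + n) * (b + n) / ((C + n) * (D + n - 1))) = Q"
          using pos nz unfolding coeff_hyp_poly m(1) Q_def K_def by (simp add: 4 mult_ac add_ac)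
        have key: "(i + 1) * (D + n) - (n + 1) * (D + i) = - ((m + 1) * (D - 1))"
          by (simp add: m(4) algebra_simps)
        have "coeff ([:0, 1:] * hyp_poly n (a + 1) (b + 1) (C + 1) D) j - coeff (hyp_poly (Suc n) a b C D) j
          = - Q / (m + 1) * (((i + 1) * (D + n) - (n + 1) * (D + i)) / (D + n))"
          unfolding 1 2 using nz by (intro mult_diff_frac) simp
        also have "\<dots> = Q * (D - 1) / (D + n)"
          unfolding key using nz(5) by simp
        also have "\<dots> = ?g * coeff (hyp_poly n a b C (D - 1)) j"
          unfolding 3[symmetric] by (simp add: mult_ac add_ac)
        finally show ?thesis by linarith
      qed (auto simp: coeff_hyp_poly coeff_pCons binomial_eq_0 split: nat.splits)
    qed
    then show "coeff ([:0, 1:] * hyp_poly n (a + 1) (b + 1) (C + 1) D) j = coeff (hyp_poly (Suc n) a b C D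
      + smult (if n = 0 then a * b / (C * D) else (a + n) * (b + n) * (D - 1) / ((C + n) * (D + n - 1) * (D + n)))
        (hyp_poly n a b C (D - 1))) j"
      using False by simp
  qed
qed

section \<open>Interlacing through alternating forms\<close>

lemma map_poly_of_real_simps:
  "map_poly complex_of_real (p - q) = map_poly of_real p - map_poly of_real q"
  "map_poly complex_of_real (smult g q) = smult (of_real g) (map_poly of_real q)"
  "map_poly complex_of_real (pCons g q) = pCons (of_real g) (map_poly of_real q)"
  "map_poly complex_of_real (pderiv p) = pderiv (map_poly of_real p)"
  "map_poly cnj (map_poly complex_of_real p) = map_poly of_real p"
  by (rule poly_eqI; simp add: coeff_map_poly coeff_pderiv coeff_pCons split: nat.split)+

lemma poly_of_real_complex:
  "poly (map_poly complex_of_real p) (of_real x) = of_real (poly p x)"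
  by (induction p) (simp_all add: map_poly_of_real_simps)

text \<open>The properties shared by Im (p(z) cnj (q(z))) with Im z > 0 and the Wronskian p' q - p
  q' at x > 0; \<tau> is the squared modulus of the point. The value on (x p, p) is a positive
  multiple of the squared modulus of \<open>p\<close> at the point. If it vanishes, \<open>p\<close>
  has a zero there; then the first form is 0 on (p, q) as well, and in the second a factor x in
  either argument only multiplies the value by x. This is the content of \<open>cancel_X\<close> and
  \<open>insert_X\<close>.\<close>

locale alternating_form =
  fixes \<omega> :: "real poly \<Rightarrow> real poly \<Rightarrow> real" and \<tau> :: real
  assumes diff_smult: "\<omega> (p - smult g q) r = \<omega> p r - g * \<omega> q r"
    and anti: "\<omega> p q = - \<omega> q p"
    and mult_X: "\<omega> ([:0, 1:] * p) ([:0, 1:] * q) = \<tau> * \<omega> p q"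
    and \<tau>: "\<tau> > 0"
    and X_self: "\<omega> ([:0, 1:] * p) p \<ge> 0"
    and cancel_X: "\<omega> ([:0, 1:] * p) p = 0 \<Longrightarrow> \<omega> ([:0, 1:] * p) q > 0 \<Longrightarrow> \<omega> p q > 0"
    and insert_X: "\<omega> ([:0, 1:] * p) p = 0 \<Longrightarrow> \<omega> p q > 0 \<Longrightarrow> \<omega> p ([:0, 1:] * q) > 0"
    and X_one: "\<omega> ([:0, 1:] * 1) 1 > 0"
begin

lemma self: "\<omega> p p = 0"
  using anti[of p p] by simp

text \<open>For a form that detects the order of zeros, \<open>up q p\<close> says that the zeros of \<open>p\<close> interlace
  those of \<open>q\<close> with those of \<open>q\<close> coming first, and \<open>down q p\<close> the same with those of \<open>p\<close> first.\<close>

definition up where "up q p \<longleftrightarrow> \<omega> p q \<ge> 0 \<and> \<omega> ([:0, 1:] * p) q > 0"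

definition down where "down q p \<longleftrightarrow> \<omega> p q > 0 \<and> \<omega> p ([:0, 1:] * q) \<ge> 0"

text \<open>Expand \<open>a'\<close> linearly: antisymmetry turns -g \<omega>(a, q) into +g
  \<omega>(q, a), so no two terms have opposite signs. Against \<open>c\<close> the first term is
  the self term \<omega>(x c, c); where it vanishes, strict positivity is recovered by
  \<open>cancel_X\<close>.\<close>

lemma down_mult_X:
  assumes "up a c" "up b c" "up a b" "g > 0"
  defines "a' \<equiv> [:0, 1:] * c - smult g a"
  shows "down b a'" "down c a'"
proof -
  have "\<omega> a' b = \<omega> ([:0, 1:] * c) b + g * \<omega> b a"
    using diff_smult[of "[:0, 1:] * c" g a b] anti[of a b] by (simp add: a'_def)
  moreover have "\<omega> a' ([:0, 1:] * b) = \<tau> * \<omega> c b + g * \<omega> ([:0, 1:] * b) a"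
    using diff_smult[of "[:0, 1:] * c" g a "[:0, 1:] * b"] anti[of a "[:0, 1:] * b"] mult_X[of c b]
    by (simp add: a'_def)
  ultimately show "down b a'"
    using assms(1-4) \<tau> unfolding up_def down_def by (auto intro!: add_pos_nonneg add_nonneg_nonneg mult_nonneg_nonneg)
  have "\<omega> a' c = \<omega> ([:0, 1:] * c) c + g * \<omega> c a"
    using diff_smult[of "[:0, 1:] * c" g a c] anti[of a c] by (simp add: a'_def)
  moreover have "\<omega> c a > 0" if "\<omega> ([:0, 1:] * c) c = 0"
    using cancel_X[OF that] assms(1) by (simp add: up_def)
  ultimately have "\<omega> a' c > 0"
    using X_self[of c] assms(1,4) unfolding up_def
    by (cases "\<omega> ([:0, 1:] * c) c = 0") (auto intro!: add_pos_nonneg mult_nonneg_nonneg)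
  moreover have "\<omega> a' ([:0, 1:] * c) = g * \<omega> ([:0, 1:] * c) a"
    using diff_smult[of "[:0, 1:] * c" g a "[:0, 1:] * c"] anti[of a "[:0, 1:] * c"] self
    by (simp add: a'_def)
  ultimately show "down c a'"
    using assms(1,4) unfolding up_def down_def by simp
qed

text \<open>The same expansion; strictness comes from the self term of \<open>a'\<close> or, if that
  vanishes, from \<open>insert_X\<close>.\<close>

lemma up_diff:
  assumes "down b a'" "g > 0"
  shows "up a' (a' - smult g b)"
proof -
  have "\<omega> (a' - smult g b) a' = g * \<omega> a' b"
    using diff_smult[of a' g b a'] anti[of b a'] self by simp
  moreover have "\<omega> ([:0, 1:] * (a' - smult g b)) a' = \<omega> ([:0, 1:] * a') a' + g * \<omega> a' ([:0, 1:] * b)"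
  proof -
    have "[:0, 1:] * (a' - smult g b) = [:0, 1:] * a' - smult g ([:0, 1:] * b)"
      by (simp add: right_diff_distrib)
    then show ?thesis
      using diff_smult[of "[:0, 1:] * a'" g "[:0, 1:] * b" a'] anti[of "[:0, 1:] * b" a'] by simp
  qed
  moreover have "\<omega> a' ([:0, 1:] * b) > 0" if "\<omega> ([:0, 1:] * a') a' = 0"
    using insert_X[OF that] assms(1) by (simp add: down_def)
  ultimately show ?thesis
    using assms X_self[of a'] unfolding up_def down_def
    by (cases "\<omega> ([:0, 1:] * a') a' = 0") (auto intro!: add_pos_nonneg mult_nonneg_nonneg)
qed

lemma down_diff:
  assumes "down c a'" "up b c" "g > 0"
  shows "down c (a' - smult g b)"
proof -
  have "\<omega> (a' - smult g b) c = \<omega> a' c + g * \<omega> c b"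
    using diff_smult[of a' g b c] anti[of b c] by simp
  moreover have "\<omega> (a' - smult g b) ([:0, 1:] * c) = \<omega> a' ([:0, 1:] * c) + g * \<omega> ([:0, 1:] * c) b"
    using diff_smult[of a' g b "[:0, 1:] * c"] anti[of b "[:0, 1:] * c"] by simp
  ultimately show ?thesis
    using assms unfolding up_def down_def
    by (auto intro!: add_pos_nonneg add_nonneg_nonneg mult_nonneg_nonneg)
qed

lemma up_diff':
  assumes "up a' b'" "down c a'" "g > 0"
  shows "up a' (b' - smult g c)"
proof -
  have "\<omega> (b' - smult g c) a' = \<omega> b' a' + g * \<omega> a' c"
    using diff_smult[of b' g c a'] anti[of c a'] by simp
  moreover have "\<omega> ([:0, 1:] * (b' - smult g c)) a' = \<omega> ([:0, 1:] * b') a' + g * \<omega> a' ([:0, 1:] * c)"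
  proof -
    have "[:0, 1:] * (b' - smult g c) = [:0, 1:] * b' - smult g ([:0, 1:] * c)"
      by (simp add: right_diff_distrib)
    then show ?thesis
      using diff_smult[of "[:0, 1:] * b'" g "[:0, 1:] * c" a'] anti[of "[:0, 1:] * c" a'] by simp
  qed
  ultimately show ?thesis
    using assms unfolding up_def down_def
    by (auto intro!: add_pos_nonneg add_nonneg_nonneg mult_nonneg_nonneg)
qed

end

locale three_term_chain =
  fixes A B C :: "nat \<Rightarrow> real poly" and \<alpha> \<beta> \<gamma> :: "nat \<Rightarrow> real"
  assumes init: "A 0 = 1" "B 0 = 1" "C 0 = 1"
    and A_Suc: "A (Suc n) = [:0, 1:] * C n - smult (\<alpha> n) (A n)"
    and B_Suc: "B (Suc n) = A (Suc n) - smult (\<beta> n) (B n)"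
    and C_Suc: "C (Suc n) = B (Suc n) - smult (\<gamma> n) (C n)"
    and pos: "\<alpha> n > 0" "\<beta> n > 0" "\<gamma> n > 0"
begin

text \<open>The induction carries the three relations \<open>up\<close> among \<open>A n\<close>,
  \<open>B n\<close>, \<open>C n\<close>; the relations \<open>down\<close> connect one index with
  the next. Strict positivity is what matters afterwards: the complex form is 0 if its first
  argument vanishes at z, and the Wronskian is 0 if its first argument has a multiple zero at
  x.\<close>

lemma form_pos:
  assumes "alternating_form \<omega> \<tau>"
  shows "\<omega> (A (Suc n)) (C n) > 0"
proof -
  interpret alternating_form \<omega> \<tau> by fact
  have down: "down (B n) (A (Suc n)) \<and> down (C n) (A (Suc n))"
    if "up (A n) (B n) \<and> up (A n) (C n) \<and> up (B n) (C n)" for n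
    using down_mult_X[of "A n" "C n" "B n" "\<alpha> n"] that pos[of n] by (simp add: A_Suc)
  have up: "up (A n) (B n) \<and> up (A n) (C n) \<and> up (B n) (C n)" for n
  proof (induction n)
    case 0
    then show ?case using X_one self[of 1] by (simp add: init up_def)
  next
    case (Suc n)
    note d = down[OF Suc]
    have "up (A (Suc n)) (B (Suc n))"
      unfolding B_Suc using d pos by (intro up_diff) auto
    moreover from this have "up (A (Suc n)) (C (Suc n))"
      unfolding C_Suc using d pos by (intro up_diff') auto
    moreover have "down (C n) (B (Suc n))"
      unfolding B_Suc using d pos Suc by (intro down_diff) auto
    then have "up (B (Suc n)) (C (Suc n))"
      unfolding C_Suc using pos by (intro up_diff) auto
    ultimately show ?case by blast
  qed
  show ?thesis using down[OF up[of n]] by (simp add: down_def)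
qed

text \<open>Apply \<open>form_pos\<close> to the form \<open>Im (p(z) * cnj q(z))\<close> at a point \<open>z\<close> of the upper half plane.\<close>
lemma roots_real:
  assumes "poly (map_poly complex_of_real (A n)) z = 0"
  shows "Im z = 0"
proof (cases n)
  case 0
  then show ?thesis using assms by (simp add: init)
next
  case (Suc m)
  let ?e = "\<lambda>(p :: real poly) z. poly (map_poly complex_of_real p) z"
  have e: "?e (p - q) w = ?e p w - ?e q w" "?e (smult g q) w = of_real g * ?e q w"
    "?e (pCons g q) w = of_real g + w * ?e q w" for p q g w
    by (simp_all add: map_poly_of_real_simps)
  have nz: "?e (A (Suc m)) z \<noteq> 0" if "Im z > 0" for z
  proof -
    have "alternating_form (\<lambda>p q. Im (?e p z * cnj (?e q z))) ((cmod z)\<^sup>2)"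
    proof
      fix p q r :: "real poly" and g :: real
      show "Im (?e (p - smult g q) z * cnj (?e r z)) = Im (?e p z * cnj (?e r z)) - g * Im (?e q z * cnj (?e r z))"
        unfolding e by (simp add: algebra_simps)
      show "Im (?e p z * cnj (?e q z)) = - Im (?e q z * cnj (?e p z))"
        by (simp add: algebra_simps)
      show "Im (?e ([:0, 1:] * p) z * cnj (?e ([:0, 1:] * q) z)) = (cmod z)\<^sup>2 * Im (?e p z * cnj (?e q z))"
      proof -
        have "?e ([:0, 1:] * p) z * cnj (?e ([:0, 1:] * q) z) = of_real ((cmod z)\<^sup>2) * (?e p z * cnj (?e q z))"
          unfolding complex_norm_square by (simp add: e mult_ac)
        moreover have "Im (of_real r * w) = r * Im w" for r w by simp
        ultimately show ?thesis by (simp only:)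
      qed
      show "(cmod z)\<^sup>2 > 0" using that by auto
      have self: "Im (?e ([:0, 1:] * p) z * cnj (?e p z)) = Im z * (cmod (?e p z))\<^sup>2" for p
      proof -
        have "?e ([:0, 1:] * p) z * cnj (?e p z) = z * of_real ((cmod (?e p z))\<^sup>2)"
          unfolding complex_norm_square by (simp add: e mult_ac)
        then show ?thesis by simp
      qed
      show "Im (?e ([:0, 1:] * p) z * cnj (?e p z)) \<ge> 0"
        unfolding self using that by simp
      show "Im (?e ([:0, 1:] * 1) z * cnj (?e 1 z)) > 0"
        unfolding self using that by simp
      assume "Im (?e ([:0, 1:] * p) z * cnj (?e p z)) = 0"
      then have 0: "?e p z = 0" unfolding self using that by simp
      show "Im (?e p z * cnj (?e q z)) > 0" if "Im (?e ([:0, 1:] * p) z * cnj (?e q z)) > 0"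
        using that by (simp add: e 0)
      show "Im (?e p z * cnj (?e ([:0, 1:] * q) z)) > 0" if "Im (?e p z * cnj (?e q z)) > 0"
        using that by (simp add: e 0)
    qed
    from form_pos[OF this, of m] show ?thesis by auto
  qed
  have "?e (A (Suc m)) (cnj z) = cnj (?e (A (Suc m)) z)"
    by (simp add: poly_cnj map_poly_of_real_simps)
  then show ?thesis
    using nz[of z] nz[of "cnj z"] assms Suc by (cases "Im z" "0 :: real" rule: linorder_cases) auto
qed

text \<open>Apply \<open>form_pos\<close> to the Wronskian at \<open>x\<close>.\<close>
lemma positive_roots_simple:
  assumes "x > 0" "poly (A n) x = 0"
  shows "poly (pderiv (A n)) x \<noteq> 0"
proof (cases n)
  case 0
  then show ?thesis using assms by (simp add: init)
next
  case (Suc m)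
  have "alternating_form (\<lambda>p q. poly (pderiv p) x * poly q x - poly p x * poly (pderiv q) x) (x\<^sup>2)"
  proof
    fix p q r :: "real poly" and g :: real
    let ?w = "\<lambda>p q. poly (pderiv p) x * poly q x - poly p x * poly (pderiv q) x"
    have X: "poly (pderiv ([:0, 1:] * p)) x = poly p x + x * poly (pderiv p) x" for p
      by (simp add: pderiv_pCons)
    show "?w (p - smult g q) r = ?w p r - g * ?w q r"
      by (simp add: pderiv_diff pderiv_smult algebra_simps)
    show "?w p q = - ?w q p" by simp
    show "?w ([:0, 1:] * p) ([:0, 1:] * q) = x\<^sup>2 * ?w p q"
      unfolding X by (simp add: algebra_simps power2_eq_square)
    show "x\<^sup>2 > 0" using assms by simp
    have self: "?w ([:0, 1:] * p) p = (poly p x)\<^sup>2" for p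
      unfolding X by (simp add: algebra_simps power2_eq_square)
    show "?w ([:0, 1:] * p) p \<ge> 0" unfolding self by simp
    show "?w ([:0, 1:] * 1) 1 > 0" unfolding self by simp
    assume "?w ([:0, 1:] * p) p = 0"
    then have 0: "poly p x = 0" unfolding self by simp
    show "?w p q > 0" if "?w ([:0, 1:] * p) q > 0"
      using that assms unfolding X by (simp add: 0 mult.assoc mult.left_commute[of _ x] zero_less_mult_iff[of x])
    show "?w p ([:0, 1:] * q) > 0" if "?w p q > 0"
      using that assms unfolding X by (simp add: 0 mult.assoc mult.left_commute[of _ x] zero_less_mult_iff[of x])
  qed
  from form_pos[OF this, of m] show ?thesis using assms Suc by auto
qed

end

text \<open>Counted over the complex numbers: a squarefree polynomial has as many roots there as its
  degree, and all of them are real.\<close>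

lemma card_roots_eq_degree:
  fixes p :: "real poly"
  assumes real: "\<And>z. poly (map_poly complex_of_real p) z = 0 \<Longrightarrow> Im z = 0"
    and simple: "\<And>x. poly p x = 0 \<Longrightarrow> poly (pderiv p) x \<noteq> 0"
    and "p \<noteq> 0"
  shows "card {x. poly p x = 0} = degree p"
proof -
  define q where "q = map_poly complex_of_real p"
  have q: "poly q (of_real x) = of_real (poly p x)" for x
    by (simp add: q_def poly_of_real_complex)
  have q': "poly (pderiv q) (of_real x) = of_real (poly (pderiv p) x)" for x
    unfolding q_def map_poly_of_real_simps(4)[symmetric] poly_of_real_complex ..
  have z: "\<exists>x. z = of_real x" if "poly q z = 0" for z
    using real[of z] that by (intro exI[of _ "Re z"]) (simp add: q_def complex_eq_iff)
  have roots: "{z. poly q z = 0} = of_real ` {x. poly p x = 0}"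
  proof (intro set_eqI iffI)
    fix z assume "z \<in> {z. poly q z = 0}"
    then show "z \<in> of_real ` {x. poly p x = 0}"
      using z[of z] by (auto simp: q)
  qed (auto simp: q)
  have "rsquarefree q"
    unfolding rsquarefree_roots
  proof (intro allI notI)
    fix z assume "poly q z = 0 \<and> poly (pderiv q) z = 0"
    then show False
      using z[of z] simple by (auto simp: q q')
  qed
  then have "smult (lead_coeff q) (\<Prod>z|poly q z = 0. [:- z, 1:]) = q"
    by (rule complex_poly_decompose_rsquarefree)
  moreover have "q \<noteq> 0" using \<open>p \<noteq> 0\<close> by (simp add: q_def map_poly_eq_0_iff)
  ultimately have "degree q = degree (\<Prod>z|poly q z = 0. [:- z, 1:])"
    by (metis degree_smult_eq leading_coeff_0_iff)
  also have "\<dots> = card {z. poly q z = 0}"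
    by (subst degree_prod_eq_sum_degree) auto
  also have "\<dots> = card {x. poly p x = 0}"
    unfolding roots by (intro card_image) (auto simp: inj_on_def)
  finally show ?thesis by (simp add: q_def degree_map_poly)
qed

text \<open>The difference of two monic polynomials of equal degree has smaller degree, yet it would
  vanish at all the common zeros.\<close>

lemma prod_linear_factors:
  fixes p :: "real poly"
  assumes "card {x. poly p x = 0} = degree p" "lead_coeff p = 1"
  shows "p = (\<Prod>x|poly p x = 0. [:- x, 1:])"
proof (rule ccontr)
  let ?R = "{x. poly p x = 0}" and ?q = "\<Prod>x|poly p x = 0. [:- x, 1:]"
  assume ne: "p \<noteq> ?q"
  have fin: "finite ?R" using assms(2) by (intro poly_roots_finite) auto
  have q: "degree ?q = degree p"
    using assms(1) by (simp add: degree_prod_eq_sum_degree)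
  have lc: "lead_coeff ?q = 1" by (simp only: lead_coeff_prod) simp
  have "degree (p - ?q) < degree p"
  proof (rule ccontr)
    assume "\<not> degree (p - ?q) < degree p"
    moreover have "degree (p - ?q) \<le> degree p"
      using q by (intro degree_diff_le) auto
    ultimately have deg: "degree (p - ?q) = degree p" by simp
    have "lead_coeff (p - ?q) = coeff p (degree p) - coeff ?q (degree ?q)"
      unfolding deg q by simp
    also have "\<dots> = 0" using lc assms(2) by simp
    finally have "p - ?q = 0" by (rule leading_coeff_0_iff[THEN iffD1])
    then show False using ne by simp
  qed
  moreover have "card {x. poly (p - ?q) x = 0} \<le> degree (p - ?q)"
    using ne by (intro card_poly_roots_bound) simp
  moreover have "card ?R \<le> card {x. poly (p - ?q) x = 0}"
    using ne fin by (intro card_mono poly_roots_finite) (auto simp: poly_prod intro!: prod_zero)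
  ultimately show False using assms(1) by simp
qed

section \<open>The three families linked by the recurrences\<close>

text \<open>If \<open>gauss_op a b c d\<close> belongs to the weights \<open>(w\<^sub>0, w\<^sub>1)\<close>, then \<open>gauss_op (b + 1) a d (c + 1)\<close> belongs to
  \<open>(w\<^sub>1, x w\<^sub>0)\<close>, and applying the shift twice gives \<open>(x w\<^sub>0, x w\<^sub>1)\<close>. This is why the recurrences
  below run through these three families.\<close>
definition gauss_op :: "real \<Rightarrow> real \<Rightarrow> real \<Rightarrow> real \<Rightarrow> nat \<Rightarrow> real poly" where
  "gauss_op a b c d n = hyp_poly n a b (c + real (n div 2)) (d + real ((n - 1) div 2))"

lemma gauss_op_0 [simp]: "gauss_op a b c d 0 = 1"
  by (simp add: gauss_op_def)

lemma degree_gauss_op [simp]: "degree (gauss_op a b c d n) = n"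
  and lead_coeff_gauss_op: "lead_coeff (gauss_op a b c d n) = 1"
  unfolding gauss_op_def by (rule lead_coeff_hyp_poly)+

text \<open>Raising the index by one advances only one of the two floors, and parity decides which.
  Hence the parameter raised by \<open>hyp_poly_shift\<close> is the one built from \<open>d\<close>
  for odd \<open>n\<close> and the one built from \<open>c\<close> for even \<open>n\<close>, so
  both \<open>d > b\<close> and \<open>c > b\<close> are used.\<close>

lemma gauss_op_shift:
  assumes "a > 0" "c > 0" "d > 0" "c > b" "d > b"
  shows "\<exists>g>0. gauss_op (b + 1) a d (c + 1) (Suc n) = gauss_op a b c d (Suc n) - smult g (gauss_op (b + 1) a d (c + 1) n)"
proof -
  have *: "\<exists>g>0. hyp_poly (Suc n) (b + 1) a C (D + 1) = hyp_poly (Suc n) a b C D - smult g (hyp_poly n (b + 1) a C D)"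
    if "C > 0" "D > 0" "D > b" for C D
  proof (intro exI conjI)
    show "real (Suc n) * (D - b) * (a + n) / ((C + n) * (D + n) * (D + n + 1)) > 0"
      using that assms by (intro divide_pos_pos mult_pos_pos) auto
    show "hyp_poly (Suc n) (b + 1) a C (D + 1) = hyp_poly (Suc n) a b C D
      - smult (real (Suc n) * (D - b) * (a + n) / ((C + n) * (D + n) * (D + n + 1))) (hyp_poly n (b + 1) a C D)"
      using hyp_poly_shift[OF that(1,2), of n a b] by (simp add: hyp_poly_commute(2)[of _ "b + 1" a])
  qed
  show ?thesis
  proof (cases "odd n")
    case True
    then obtain N where n: "n = 2 * N + 1" by (auto elim: oddE)
    have "gauss_op (b + 1) a d (c + 1) (Suc n) = hyp_poly (Suc n) (b + 1) a (c + 1 + N) (d + N + 1)"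
      "gauss_op (b + 1) a d (c + 1) n = hyp_poly n (b + 1) a (c + 1 + N) (d + N)"
      unfolding gauss_op_def n by (subst hyp_poly_commute(1), simp add: add_ac)+
    moreover have "gauss_op a b c d (Suc n) = hyp_poly (Suc n) a b (c + 1 + N) (d + N)"
      by (simp add: gauss_op_def n add_ac)
    ultimately show ?thesis using *[of "c + 1 + N" "d + N"] assms by simp
  next
    case False
    then obtain N where n: "n = 2 * N" by (auto elim: evenE)
    have 1: "gauss_op (b + 1) a d (c + 1) (Suc n) = hyp_poly (Suc n) (b + 1) a (d + N) (c + N + 1)"
      "gauss_op a b c d (Suc n) = hyp_poly (Suc n) a b (d + N) (c + N)"
      by (simp_all add: gauss_op_def n hyp_poly_commute(1)[of _ _ _ "c + _"] add_ac)
    \<comment> \<open>For \<open>N = 0\<close> truncated subtraction leaves \<open>c + 1\<close>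
      instead of \<open>c + N\<close>; this is harmless, since the polynomial of index 0 is 1 for
      all parameters.\<close>
    have "gauss_op (b + 1) a d (c + 1) n = hyp_poly n (b + 1) a (d + N) (c + N)"
      by (cases N) (simp_all add: gauss_op_def n add_ac)
    with 1 *[of "d + N" "c + N"] assms show ?thesis by simp
  qed
qed

lemma gauss_op_mult_X:
  assumes "a > 0" "b > 0" "c > 0" "d > 0"
  shows "\<exists>g>0. gauss_op a b c d (Suc n) = [:0, 1:] * gauss_op (a + 1) (b + 1) (c + 1) (d + 1) n - smult g (gauss_op a b c d n)"
proof -
  have *: "\<exists>g>0. hyp_poly (Suc n) a b C D = [:0, 1:] * hyp_poly n (a + 1) (b + 1) (C + 1) D - smult g (hyp_poly n a b C (D - 1))"
    if "C > 0" "D > 1 \<or> n = 0 \<and> D > 0" for C D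
  proof (intro exI conjI)
    show "(if n = 0 then a * b / (C * D) else (a + n) * (b + n) * (D - 1) / ((C + n) * (D + n - 1) * (D + n))) > 0"
      using that assms by (auto intro!: divide_pos_pos mult_pos_pos)
    show "hyp_poly (Suc n) a b C D = [:0, 1:] * hyp_poly n (a + 1) (b + 1) (C + 1) D
      - smult (if n = 0 then a * b / (C * D) else (a + n) * (b + n) * (D - 1) / ((C + n) * (D + n - 1) * (D + n))) (hyp_poly n a b C (D - 1))"
      using hyp_poly_mult_X[OF that, of a b] by (simp del: mult_pCons_left)
  qed
  show ?thesis
  proof (cases "odd n")
    case True
    then obtain N where n: "n = 2 * N + 1" by (auto elim: oddE)
    have "gauss_op (a + 1) (b + 1) (c + 1) (d + 1) n = hyp_poly n (a + 1) (b + 1) (d + N + 1) (c + N + 1)"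
      "gauss_op a b c d (Suc n) = hyp_poly (Suc n) a b (d + N) (c + N + 1)"
      "gauss_op a b c d n = hyp_poly n a b (d + N) (c + N + 1 - 1)"
      unfolding gauss_op_def n by (subst hyp_poly_commute(1), simp add: add_ac)+
    with *[of "d + N" "c + N + 1"] assms show ?thesis by simp
  next
    case False
    then obtain N where n: "n = 2 * N" by (auto elim: evenE)
    have "gauss_op (a + 1) (b + 1) (c + 1) (d + 1) n = hyp_poly n (a + 1) (b + 1) (c + N + 1) (d + N)"
      "gauss_op a b c d (Suc n) = hyp_poly (Suc n) a b (c + N) (d + N)"
      "gauss_op a b c d n = hyp_poly n a b (c + N) (d + N - 1)"
      by (cases N; simp add: gauss_op_def n add_ac)+
    moreover have "d + N > 1 \<or> n = 0 \<and> d + N > 0" using assms n by (cases N) auto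
    ultimately show ?thesis using *[of "c + N" "d + N"] assms by simp
  qed
qed

text \<open>The coefficients strictly alternate in sign, so at \<open>x \<le> 0\<close> all terms
  have the same sign and the constant one is not 0.\<close>

lemma gauss_op_nonpos:
  assumes "a > 0" "b > 0" "c > 0" "d > 0" "x \<le> 0"
  shows "poly (gauss_op a b c d n) x \<noteq> 0"
proof -
  let ?p = "gauss_op a b c d n"
  have coeff: "(-1) ^ (n - j) * coeff ?p j > 0" if "j \<le> n" for j
    using that assms unfolding gauss_op_def coeff_hyp_poly
    by (auto simp: mult.assoc[symmetric] simp flip: power_add intro!: mult_pos_pos divide_pos_pos pochhammer_pos add_pos_nonneg)
  have eq: "(-1) ^ n * poly ?p x = (\<Sum>j\<le>n. ((-1) ^ (n - j) * coeff ?p j) * (- x) ^ j)"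
    unfolding poly_altdef degree_gauss_op sum_distrib_left
  proof (intro sum.cong refl)
    fix j assume "j \<in> {..n}"
    then have "(-1 :: real) ^ n = (-1) ^ (n - j) * (-1) ^ j" by (simp flip: power_add)
    then show "(-1) ^ n * (coeff ?p j * x ^ j) = ((-1) ^ (n - j) * coeff ?p j) * (- x) ^ j"
      by (simp add: power_minus[of x])
  qed
  have "0 < ((-1) ^ (n - 0) * coeff ?p 0) * (- x) ^ 0"
    using coeff[of 0] by simp
  also have "\<dots> \<le> (\<Sum>j\<le>n. ((-1) ^ (n - j) * coeff ?p j) * (- x) ^ j)"
  proof (rule member_le_sum)
    fix j assume "j \<in> {..n} - {0}"
    then show "0 \<le> ((-1) ^ (n - j) * coeff ?p j) * (- x) ^ j"
      using assms coeff[of j] by (intro mult_nonneg_nonneg[of "(-1) ^ (n - j) * coeff ?p j"]) auto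
  qed auto
  finally show ?thesis using eq by auto
qed

theorem gauss_op_roots:
  assumes "a > 0" "b > 0" "c > 0" "d > 0" "min c d > max a b"
  shows "card {x. poly (gauss_op a b c d n) x = 0} = n"
    and "poly (gauss_op a b c d n) x = 0 \<Longrightarrow> x > 0"
proof -
  have "\<exists>\<alpha>. \<forall>n. \<alpha> n > 0 \<and> gauss_op a b c d (Suc n)
      = [:0, 1:] * gauss_op (a + 1) (b + 1) (c + 1) (d + 1) n - smult (\<alpha> n) (gauss_op a b c d n)"
    using gauss_op_mult_X[OF assms(1-4)] by (intro choice allI) blast
  then obtain \<alpha> where \<alpha>: "\<And>n. \<alpha> n > 0" "\<And>n. gauss_op a b c d (Suc n)
      = [:0, 1:] * gauss_op (a + 1) (b + 1) (c + 1) (d + 1) n - smult (\<alpha> n) (gauss_op a b c d n)"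
    by blast
  have "\<exists>\<beta>. \<forall>n. \<beta> n > 0 \<and> gauss_op (b + 1) a d (c + 1) (Suc n)
      = gauss_op a b c d (Suc n) - smult (\<beta> n) (gauss_op (b + 1) a d (c + 1) n)"
    using gauss_op_shift[of a c d b] assms by (intro choice allI) simp
  then obtain \<beta> where \<beta>: "\<And>n. \<beta> n > 0" "\<And>n. gauss_op (b + 1) a d (c + 1) (Suc n)
      = gauss_op a b c d (Suc n) - smult (\<beta> n) (gauss_op (b + 1) a d (c + 1) n)"
    by blast
  \<comment> \<open>The second shift starts from the parameters (b + 1, a; d, c + 1), so its
    hypotheses read \<open>d > a\<close> and \<open>c + 1 > a\<close>; it closes the cycle at all
    four parameters raised by one.\<close>
  have "\<exists>\<gamma>. \<forall>n. \<gamma> n > 0 \<and> gauss_op (a + 1) (b + 1) (c + 1) (d + 1) (Suc n)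
      = gauss_op (b + 1) a d (c + 1) (Suc n) - smult (\<gamma> n) (gauss_op (a + 1) (b + 1) (c + 1) (d + 1) n)"
    using gauss_op_shift[of "b + 1" d "c + 1" a] assms by (intro choice allI) simp
  then obtain \<gamma> where \<gamma>: "\<And>n. \<gamma> n > 0" "\<And>n. gauss_op (a + 1) (b + 1) (c + 1) (d + 1) (Suc n)
      = gauss_op (b + 1) a d (c + 1) (Suc n) - smult (\<gamma> n) (gauss_op (a + 1) (b + 1) (c + 1) (d + 1) n)"
    by blast
  interpret three_term_chain "gauss_op a b c d" "gauss_op (b + 1) a d (c + 1)"
      "gauss_op (a + 1) (b + 1) (c + 1) (d + 1)" \<alpha> \<beta> \<gamma>
    by unfold_locales (rule gauss_op_0 \<alpha> \<beta> \<gamma>)+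
  show pos: "x > 0" if "poly (gauss_op a b c d n) x = 0" for x
    using gauss_op_nonpos[of a b c d x n] assms that by (cases "x > 0") auto
  have "gauss_op a b c d n \<noteq> 0" using lead_coeff_gauss_op[of a b c d n] by auto
  then have "card {x. poly (gauss_op a b c d n) x = 0} = degree (gauss_op a b c d n)"
    by (intro card_roots_eq_degree roots_real positive_roots_simple pos)
  then show "card {x. poly (gauss_op a b c d n) x = 0} = n" by simp
qed

section \<open>Orthogonality\<close>

text \<open>This is an n-th finite difference. Pascal's rule reduces it to the sum with
  \<open>n - 1\<close> for the first difference of \<open>q\<close>, whose degree is
  smaller.\<close>

lemma alternating_binomial_sum_poly:
  fixes q :: "real poly"
  assumes "degree q < n"
  shows "(\<Sum>j\<le>n. (-1) ^ j * real (n choose j) * poly q (real j)) = 0"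
  using assms
proof (induction n arbitrary: q)
  case (Suc m)
  define r where "r = q - pcompose q [:1, 1:]"
  have r: "poly r (real j) = poly q (real j) - poly q (real (Suc j))" for j
    by (simp add: r_def poly_pcompose add.commute)
  have "(\<Sum>j\<le>Suc m. (-1) ^ j * real (Suc m choose j) * poly q (real j))
      = poly q 0 + (\<Sum>j\<le>m. (-1) ^ Suc j * real (Suc m choose Suc j) * poly q (real (Suc j)))"
    by (subst sum.atMost_Suc_shift) simp
  also have "(\<Sum>j\<le>m. (-1) ^ Suc j * real (Suc m choose Suc j) * poly q (real (Suc j)))
      = (\<Sum>j\<le>m. (-1) ^ Suc j * real (m choose Suc j) * poly q (real (Suc j)))
        - (\<Sum>j\<le>m. (-1) ^ j * real (m choose j) * poly q (real (Suc j)))"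
    unfolding sum_subtractf[symmetric] by (intro sum.cong refl) (simp add: algebra_simps)
  also have "poly q 0 + ((\<Sum>j\<le>m. (-1) ^ Suc j * real (m choose Suc j) * poly q (real (Suc j)))
        - (\<Sum>j\<le>m. (-1) ^ j * real (m choose j) * poly q (real (Suc j))))
      = (\<Sum>j\<le>Suc m. (-1) ^ j * real (m choose j) * poly q (real j))
        - (\<Sum>j\<le>m. (-1) ^ j * real (m choose j) * poly q (real (Suc j)))"
    by (subst sum.atMost_Suc_shift) simp
  also have "\<dots> = (\<Sum>j\<le>m. (-1) ^ j * real (m choose j) * poly r (real j))"
    by (simp add: r algebra_simps sum_subtractf)
  also have "\<dots> = 0"
  proof (cases "degree q = 0")
    case True
    then obtain c where "q = [:c:]" by (auto elim: degree_eq_zeroE)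
    then show ?thesis by (simp add: r_def)
  next
    case False
    have deg: "degree (pcompose q [:1, 1:]) = degree q" by (simp add: degree_pcompose)
    have lc: "coeff (pcompose q [:1, 1:]) (degree q) = coeff q (degree q)"
      using lead_coeff_comp[of "[:1, 1:]" q] deg by simp
    have "degree r < degree q"
    proof (rule le_neq_implies_less)
      show "degree r \<le> degree q" unfolding r_def by (rule degree_diff_le) (simp_all add: deg)
      show "degree r \<noteq> degree q"
      proof
        assume "degree r = degree q"
        then have "lead_coeff r = 0" using lc by (simp add: r_def)
        then have "r = 0" by (simp only: leading_coeff_0_iff)
        then show False using \<open>degree r = degree q\<close> False by simp
      qed
    qed
    then show ?thesis using Suc by simp
  qed
  finally show ?case .
qed simp

lemma poly_pochhammer_linear:
  fixes s x :: real
  shows "poly (pochhammer [:s, 1:] k) x = pochhammer (s + x) k"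
  by (simp add: pochhammer_prod poly_prod add_ac)

lemma degree_pochhammer_linear: "degree (pochhammer [:s :: real, 1:] k) = k"
proof -
  have "degree (\<Prod>i = 0..<k. [:s, 1:] + of_nat i) = (\<Sum>i = 0..<k. degree ([:s, 1:] + of_nat i))"
    by (intro degree_prod_eq_sum_degree) (auto simp: of_nat_poly)
  then show ?thesis by (simp add: pochhammer_prod of_nat_poly)
qed

text \<open>Split (c)_(N+i) in two ways. The gain is that the right side is a polynomial in
  \<open>i\<close> of degree \<open>N - k\<close>.\<close>

lemma pochhammer_ratio:
  fixes c :: real
  assumes "c > 0" "k \<le> N"
  shows "pochhammer (c + N) i / pochhammer c (k + i) = pochhammer (c + k + i) (N - k) / pochhammer c N"
proof -
  have "pochhammer c (N + i) = pochhammer c N * pochhammer (c + N) i"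
    by (rule pochhammer_product')
  moreover have "pochhammer c ((k + i) + (N - k)) = pochhammer c (k + i) * pochhammer (c + real (k + i)) (N - k)"
    by (rule pochhammer_product')
  moreover have "(k + i) + (N - k) = N + i" using assms by simp
  moreover have "pochhammer c N > 0" "pochhammer c (k + i) > 0"
    using assms by (auto intro!: pochhammer_pos)
  ultimately show ?thesis by (simp add: field_simps)
qed

text \<open>After cancellation the \<open>i\<close>-th summand is a constant times (-1)^i binom(n,
  i) q(i), where q has degree k + l + (N - l) + (M - k) = N + M for all \<open>k\<close> and
  \<open>l\<close>. Keeping \<open>k\<close> and \<open>l\<close> separate covers both weights:
  \<open>l = k\<close> for the first, \<open>l = k + 1\<close> for the second.\<close>

lemma hyp_poly_orthogonal:
  fixes a b c d :: real
  assumes "a > 0" "b > 0" "c > 0" "d > 0" "k \<le> M" "l \<le> N" "N + M < n"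
  shows "(\<Sum>i\<le>n. coeff (hyp_poly n a b (c + N) (d + M)) i *
    (pochhammer a (k + i) * pochhammer b (l + i) / (pochhammer c (l + i) * pochhammer d (k + i)))) = 0"
proof -
  define q where "q = pochhammer [:a, 1:] k * pochhammer [:b, 1:] l * (pochhammer [:c + l, 1:] (N - l) * pochhammer [:d + k, 1:] (M - k))"
  have "degree q \<le> (k + l) + ((N - l) + (M - k))"
    unfolding q_def by (intro order.trans[OF degree_mult_le] add_mono) (simp_all add: degree_pochhammer_linear)
  then have deg: "degree q < n" using assms by simp
  define K where "K = (-1) ^ n * (pochhammer a n * pochhammer b n) / (pochhammer (c + N) n * pochhammer (d + M) n)
    / (pochhammer c N * pochhammer d M)"
  have "coeff (hyp_poly n a b (c + N) (d + M)) i *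
    (pochhammer a (k + i) * pochhammer b (l + i) / (pochhammer c (l + i) * pochhammer d (k + i)))
    = K * ((-1) ^ i * real (n choose i) * poly q (real i))" if "i \<le> n" for i
  proof -
    have split: "pochhammer x n = pochhammer x i * pochhammer (x + i) (n - i)" for x :: real
      using pochhammer_product'[of x i "n - i"] that by simp
    have split': "pochhammer x (m + i) = pochhammer x i * pochhammer (x + i) m" for x :: real and m
      using pochhammer_product'[of x i m] by (simp add: add.commute)
    have q: "poly q (real i) = pochhammer (a + i) k * pochhammer (b + i) l *
      (pochhammer (c + l + i) (N - l) * pochhammer (d + k + i) (M - k))"
      by (simp add: q_def poly_pochhammer_linear)
    have pos: "pochhammer a i > 0" "pochhammer b i > 0" "pochhammer (c + N) i > 0" "pochhammer (d + M) i > 0"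
      "pochhammer (c + N + i) (n - i) > 0" "pochhammer (d + M + i) (n - i) > 0"
      using assms by (auto intro!: pochhammer_pos add_pos_nonneg)
    have sgn: "(-1 :: real) ^ (n - i) = (-1) ^ n * (-1) ^ i"
      using that by (simp add: minus_one_power_iff)
    have "pochhammer a (k + i) * pochhammer b (l + i) / (pochhammer c (l + i) * pochhammer d (k + i))
      = pochhammer a i * pochhammer b i / (pochhammer (c + N) i * pochhammer (d + M) i)
        * (pochhammer (a + i) k * pochhammer (b + i) l
          * ((pochhammer (c + N) i / pochhammer c (l + i)) * (pochhammer (d + M) i / pochhammer d (k + i))))"
      using pos unfolding split' by simp
    also have "\<dots> = pochhammer a i * pochhammer b i / (pochhammer (c + N) i * pochhammer (d + M) i)
        * (poly q (real i) / (pochhammer c N * pochhammer d M))"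
      unfolding pochhammer_ratio[OF assms(3,6)] pochhammer_ratio[OF assms(4,5)] q by simp
    finally have 1: "pochhammer a (k + i) * pochhammer b (l + i) / (pochhammer c (l + i) * pochhammer d (k + i))
      = pochhammer a i * pochhammer b i / (pochhammer (c + N) i * pochhammer (d + M) i)
        * (poly q (real i) / (pochhammer c N * pochhammer d M))" .
    show ?thesis
      unfolding 1 K_def coeff_hyp_poly sgn split[of a] split[of b] split[of "c + N"] split[of "d + M"]
      using pos by (simp add: mult_ac)
  qed
  then have "(\<Sum>i\<le>n. coeff (hyp_poly n a b (c + N) (d + M)) i *
      (pochhammer a (k + i) * pochhammer b (l + i) / (pochhammer c (l + i) * pochhammer d (k + i))))
    = K * (\<Sum>i\<le>n. (-1) ^ i * real (n choose i) * poly q (real i))"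
    unfolding sum_distrib_left by (intro sum.cong) auto
  then show ?thesis using alternating_binomial_sum_poly[OF deg] by simp
qed

text \<open>Since the functional \<open>L n\<close> does not vanish at \<open>P n\<close>, the orthogonality conditions are
  triangular in the basis \<open>P\<close>, which yields uniqueness.\<close>
lemma orthogonal_unique:
  fixes P :: "nat \<Rightarrow> real poly" and L :: "nat \<Rightarrow> real poly \<Rightarrow> real"
  assumes deg: "\<And>n. degree (P n) = n" and monic: "\<And>n. lead_coeff (P n) = 1"
    and add: "\<And>m p q. L m (p + q) = L m p + L m q"
    and smult: "\<And>m c p. L m (smult c p) = c * L m p"
    and zero: "\<And>m n. m < n \<Longrightarrow> L m (P n) = 0"
    and nz: "\<And>n. L n (P n) \<noteq> 0"
    and Q: "degree Q = n" "lead_coeff Q = 1" "\<And>m. m < n \<Longrightarrow> L m Q = 0"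
  shows "Q = P n"
proof -
  have expand: "\<exists>e. p = (\<Sum>i<k. smult (e i) (P i))" if "p = 0 \<or> degree p < k" for p k
    using that
  proof (induction k arbitrary: p)
    case (Suc k)
    define r where "r = p - smult (coeff p k) (P k)"
    have "r = 0 \<or> degree r < k"
    proof (cases "r = 0")
      case False
      have "degree p \<le> k" using Suc.prems by auto
      then have "degree r \<le> k"
        unfolding r_def using deg[of k] by (intro degree_diff_le order.trans[OF degree_smult_le]) auto
      moreover have "coeff r k = 0"
        using monic[of k] deg[of k] by (simp add: r_def)
      ultimately show ?thesis
        using False by (metis le_neq_implies_less leading_coeff_0_iff)
    qed simp
    then obtain e where "r = (\<Sum>i<k. smult (e i) (P i))" using Suc.IH by blast
    then have "p = (\<Sum>i<Suc k. smult ((e(k := coeff p k)) i) (P i))"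
      by (simp add: r_def diff_eq_eq)
    then show ?case by blast
  qed simp
  define D where "D = Q - P n"
  have "D = 0 \<or> degree D < n"
  proof (cases "D = 0")
    case False
    have "degree D \<le> n" unfolding D_def using deg Q by (intro degree_diff_le) auto
    moreover have "coeff D n = 0" using monic[of n] deg[of n] Q by (simp add: D_def)
    ultimately show ?thesis using False by (metis le_neq_implies_less leading_coeff_0_iff)
  qed simp
  then obtain e where e: "D = (\<Sum>i<n. smult (e i) (P i))" using expand by blast
  have L0: "L m 0 = 0" for m using smult[of m 0 0] by simp
  have Lsum: "L m (\<Sum>i\<in>S. smult (e i) (P i)) = (\<Sum>i\<in>S. e i * L m (P i))" if "finite S" for m S
    using that by (induction S rule: finite_induct) (simp_all add: L0 add smult)
  have LD: "L m D = 0" if "m < n" for m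
  proof -
    have "L m Q = L m (D + P n)" by (simp add: D_def)
    then show ?thesis using Q(3)[OF that] zero[OF that] by (simp add: add)
  qed
  have "e m = 0" if "m < n" for m
    using that
  proof (induction m rule: less_induct)
    case (less m)
    have "0 = (\<Sum>i<n. e i * L m (P i))"
      using LD[OF less.prems] Lsum[of "{..<n}" m] by (simp add: e)
    also have "\<dots> = (\<Sum>i\<in>{m}. e i * L m (P i))"
      using less by (intro sum.mono_neutral_right) (auto simp: zero nat_neq_iff)
    finally show ?case using nz[of m] by simp
  qed
  then have "D = 0" unfolding e by (intro sum.neutral) simp
  then show ?thesis by (simp add: D_def)
qed

lemma has_bochner_integral_poly_weight_vec:
  fixes a b c d :: real
  assumes "a > 0" "b > 0" "c > b" "d > b" "c + d > a + b" and j: "j \<in> {0, 1}"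
  shows "has_bochner_integral lborel (\<lambda>x. indicator {0<..<1} x *\<^sub>R (x ^ k * poly p x * weight_vec a b c d j x))
    (\<Sum>i\<le>degree p. coeff p i * moment_W a (b + j) (c + j) d (k + i))"
proof -
  have "has_bochner_integral lborel
    (\<lambda>x. \<Sum>i\<le>degree p. coeff p i * (indicator {0<..<1} x *\<^sub>R (x ^ (k + i) * weight_vec a b c d j x)))
    (\<Sum>i\<le>degree p. coeff p i * moment_W a (b + j) (c + j) d (k + i))"
    using j has_bochner_integral_weight_vec[OF assms(1-5), of _ j]
    by (intro has_bochner_integral_sum has_bochner_integral_mult_right) auto
  moreover have "(\<Sum>i\<le>degree p. coeff p i * (indicator {0<..<1} x *\<^sub>R (x ^ (k + i) * weight_vec a b c d j x)))
    = indicator {0<..<1} x *\<^sub>R (x ^ k * poly p x * weight_vec a b c d j x)" for x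
    by (simp add: poly_altdef sum_distrib_left sum_distrib_right power_add mult_ac)
  ultimately show ?thesis by simp
qed

theorem monic_2_orthogonal_eq_gauss_op:
  fixes a b c d :: real
  assumes pos: "a > 0" "b > 0" "c > 0" "d > 0" and "min c d > max a b"
    and P: "monic_2_orthogonal (weight_vec a b c d) P"
  shows "P n = gauss_op a b c d n"
proof -
  \<comment> \<open>Both families of conditions are merged into one sequence by m = 2k + j: the
    integral has to vanish for \<open>m < n\<close> and not for \<open>m = n\<close>.\<close>
  define L where "L m p = (LINT x:{0<..<1}|lborel. x ^ (m div 2) * poly p x * weight_vec a b c d (m mod 2) x)" for m p
  have hb: "has_bochner_integral lborel (\<lambda>x. indicator {0<..<1} x *\<^sub>R (x ^ k * poly p x * weight_vec a b c d j x))
    (\<Sum>i\<le>degree p. coeff p i * moment_W a (b + j) (c + j) d (k + i))" if "j \<in> {0, 1}" for p k j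
    using assms that by (intro has_bochner_integral_poly_weight_vec) auto
  have orth: "2 * k + j + 1 \<le> n \<Longrightarrow> (LINT x:{0<..<1}|lborel. x ^ k * poly (P n) x * weight_vec a b c d j x) = 0"
    "n = 2 * k + j \<Longrightarrow> (LINT x:{0<..<1}|lborel. x ^ k * poly (P n) x * weight_vec a b c d j x) \<noteq> 0"
    if "j \<in> {0, 1}" for j k n
    using P[unfolded monic_2_orthogonal_def, THEN conjunct2, rule_format, OF that, of k n]
    by (simp_all only: simp_thms)
  have m2: "m mod 2 \<in> {0, 1}" for m :: nat by auto
  have L: "L m p = (\<Sum>i\<le>degree p. coeff p i * moment_W a (b + (m mod 2)) (c + (m mod 2)) d (m div 2 + i))" for m p
    unfolding L_def set_lebesgue_integral_def
    using hb[OF m2, of "m div 2" p] by (simp add: has_bochner_integral_iff)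
  have int: "set_integrable lborel {0<..<1} (\<lambda>x. x ^ (m div 2) * poly p x * weight_vec a b c d (m mod 2) x)" for m p
    unfolding set_integrable_def
    using hb[OF m2, of "m div 2" p] by (simp add: has_bochner_integral_iff)
  show ?thesis
  proof (rule sym, rule orthogonal_unique[where L = L])
    show "degree (P n) = n" "lead_coeff (P n) = 1" for n
      using P unfolding monic_2_orthogonal_def by blast+
    show "L m (p + q) = L m p + L m q" for m p q
      unfolding L_def using set_integral_add(2)[OF int[of m p] int[of m q]]
      by (simp add: algebra_simps)
    show "L m (smult e p) = e * L m p" for m e p
    proof -
      have "L m (smult e p) = (LINT x:{0<..<1}|lborel. e * (x ^ (m div 2) * poly p x * weight_vec a b c d (m mod 2) x))"
        unfolding L_def by (simp add: mult_ac)
      then show ?thesis unfolding L_def by simp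
    qed
    show "L m (P n) = 0" if "m < n" for m n
      unfolding L_def by (rule orth(1)[OF m2]) (use that in simp)
    show "L n (P n) \<noteq> 0" for n
      unfolding L_def by (rule orth(2)[OF m2]) simp
    show "degree (gauss_op a b c d n) = n" "lead_coeff (gauss_op a b c d n) = 1"
      by (rule degree_gauss_op lead_coeff_gauss_op)+
    fix m assume "m < n"
    \<comment> \<open>For odd \<open>m\<close> the quotient (b+1)_k / (c+1)_k is c/b times (b)_(k+1)
      / (c)_(k+1), which explains \<open>l\<close> and the constant \<open>c / b\<close>
      below.\<close>
    define k l where "k = m div 2" and "l = m div 2 + m mod 2"
    have kl: "k \<le> (n - 1) div 2" "l \<le> n div 2" "n div 2 + (n - 1) div 2 < n"
      using \<open>m < n\<close> unfolding k_def l_def by presburger+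
    have "moment_W a (b + (m mod 2)) (c + (m mod 2)) d (m div 2 + i) = (if m mod 2 = 0 then 1 else c / b) *
      (pochhammer a (k + i) * pochhammer b (l + i) / (pochhammer c (l + i) * pochhammer d (k + i)))" for i
    proof (cases "m mod 2 = 0")
      case False
      then have m: "m mod 2 = 1" "l = Suc k" by (auto simp: k_def l_def)
      have "pochhammer b (l + i) = b * pochhammer (b + 1) (k + i)" "pochhammer c (l + i) = c * pochhammer (c + 1) (k + i)"
        by (simp_all add: m pochhammer_rec)
      then show ?thesis using pos by (simp add: moment_W_def m flip: k_def)
    qed (simp add: moment_W_def k_def l_def)
    then have "L m (gauss_op a b c d n) = (if m mod 2 = 0 then 1 else c / b) * (\<Sum>i\<le>n. coeff (gauss_op a b c d n) i *
      (pochhammer a (k + i) * pochhammer b (l + i) / (pochhammer c (l + i) * pochhammer d (k + i))))"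
      unfolding L degree_gauss_op sum_distrib_left by (intro sum.cong) (simp_all only: mult.left_commute)
    also have "\<dots> = 0"
      unfolding gauss_op_def using hyp_poly_orthogonal[OF pos kl] by simp
    finally show "L m (gauss_op a b c d n) = 0" .
  qed
qed

section \<open>Power sums of the zeros\<close>

unbundle no vec_syntax
unbundle fps_syntax

text \<open>For R the product of the factors 1 - s X, the logarithmic derivative X R'/R is minus the
  sum of s X / (1 - s X). Subtracting it from the number of factors leaves the sum of 1 / (1 - s X),
  which generates the power sums.\<close>

lemma fps_log_derivative_prod:
  fixes S :: "real set"
  assumes "finite S"
  defines "R \<equiv> \<Prod>s\<in>S. (1 - fps_const s * fps_X)"
  shows "of_nat (card S) * R - fps_X * fps_deriv R = Abs_fps (\<lambda>k. \<Sum>s\<in>S. s ^ k) * R"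
  using assms(1) unfolding R_def
proof (induction S rule: finite_induct)
  case empty
  then show ?case by (simp add: fps_zero_def[symmetric])
next
  case (insert s S)
  define R where "R = (\<Prod>s\<in>S. (1 - fps_const s * fps_X))"
  define g where "g = Abs_fps (\<lambda>k. s ^ k)"
  define h where "h = Abs_fps (\<lambda>k. \<Sum>s\<in>S. s ^ k)"
  have g: "g * (1 - fps_const s * fps_X) = 1"
  proof (rule fps_ext)
    fix n show "(g * (1 - fps_const s * fps_X)) $ n = 1 $ n"
      by (cases n) (simp_all add: g_def right_diff_distrib mult.left_commute[of _ "fps_const s"])
  qed
  have IH: "of_nat (card S) * R - fps_X * fps_deriv R = h * R"
    using insert.IH by (simp add: R_def h_def)
  have prod: "(\<Prod>s\<in>insert s S. (1 - fps_const s * fps_X)) = (1 - fps_const s * fps_X) * R"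
    using insert by (simp add: R_def)
  have sum: "Abs_fps (\<lambda>k. \<Sum>s\<in>insert s S. s ^ k) = g + h"
    using insert by (simp add: g_def h_def fps_eq_iff)
  have deriv: "fps_deriv ((1 - fps_const s * fps_X) * R) = (1 - fps_const s * fps_X) * fps_deriv R - fps_const s * R"
    by (simp del: fps_const_neg)
  have "of_nat (card (insert s S)) * ((1 - fps_const s * fps_X) * R)
      - fps_X * ((1 - fps_const s * fps_X) * fps_deriv R - fps_const s * R)
      = (1 - fps_const s * fps_X) * (of_nat (card S) * R - fps_X * fps_deriv R) + R"
    using insert by (simp add: algebra_simps)
  also have "\<dots> = (g * (1 - fps_const s * fps_X)) * R + (1 - fps_const s * fps_X) * (h * R)"
    unfolding IH g by simp
  also have "\<dots> = (g + h) * ((1 - fps_const s * fps_X) * R)"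
    by (simp add: algebra_simps)
  finally show ?case unfolding prod sum deriv .
qed

definition power_sums :: "real poly \<Rightarrow> real fps" where
  "power_sums p = Abs_fps (\<lambda>k. \<Sum>x|poly p x = 0. x ^ k)"

text \<open>The reversed polynomial x^n p(1/x) is the product of 1 - s x over the zeros s, because
  there are as many distinct zeros as the degree.\<close>

lemma power_sums_log_derivative:
  fixes p :: "real poly"
  assumes "card {x. poly p x = 0} = degree p" "lead_coeff p = 1"
  defines "R \<equiv> fps_of_poly (reflect_poly p)"
  shows "of_nat (degree p) * R - fps_X * fps_deriv R = power_sums p * R"
proof -
  have linear: "fps_of_poly (reflect_poly [:- x, 1:]) = 1 - fps_const x * fps_X" for x :: real
  proof -
    have "reflect_poly [:- x, 1:] = [:1, - x:]"
      by (rule poly_eqI) (auto simp: coeff_reflect_poly coeff_pCons le_Suc_eq split: nat.split)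
    then show ?thesis by (simp add: fps_of_poly_linear')
  qed
  have "finite {x. poly p x = 0}" using assms(2) by (intro poly_roots_finite) auto
  from fps_log_derivative_prod[OF this] show ?thesis
    using arg_cong[OF prod_linear_factors[OF assms(1,2)], of "\<lambda>p. fps_of_poly (reflect_poly p)"] assms(1)
    by (simp add: R_def power_sums_def reflect_poly_prod fps_of_poly_prod linear)
qed

lemma hyp_poly_coeff_rec:
  assumes "C > 0" "D > 0"
  shows "coeff (hyp_poly n a b C D) (Suc j) * ((real j + 1) * (a + j) * (b + j))
    = - coeff (hyp_poly n a b C D) j * ((real n - j) * (C + j) * (D + j))"
proof (cases "j < n")
  case True
  define m where "m = n - Suc j"
  have m: "n - Suc j = m" "n - j = Suc m" using True by (auto simp: m_def)
  have "Suc j * (n choose Suc j) = (n - j) * (n choose j)"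
    using binomial_absorb_comp[of n j] binomial_absorption[of j n] by simp
  then have "real (Suc j * (n choose Suc j)) = real ((n - j) * (n choose j))" by (simp only:)
  then have ch: "(real j + 1) * real (n choose Suc j) = (real n - real j) * real (n choose j)"
    using True by (simp add: of_nat_diff algebra_simps)
  define Y where "Y = (-1) ^ m * (pochhammer (a + j + 1) m * pochhammer (b + j + 1) m)
    / (pochhammer (C + j + 1) m * pochhammer (D + j + 1) m)"
  have nz: "C + j > 0" "D + j > 0" using assms by (auto intro!: add_pos_nonneg)
  have 1: "coeff (hyp_poly n a b C D) (Suc j) = real (n choose Suc j) * Y"
    unfolding coeff_hyp_poly m Y_def by (simp add: add_ac)
  have 2: "coeff (hyp_poly n a b C D) j = - real (n choose j) * Y * ((a + j) * (b + j)) / ((C + j) * (D + j))"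
    unfolding coeff_hyp_poly m Y_def by (simp add: pochhammer_rec mult_ac add_ac)
  have "coeff (hyp_poly n a b C D) (Suc j) * ((real j + 1) * (a + j) * (b + j))
      = ((real j + 1) * real (n choose Suc j)) * Y * ((a + j) * (b + j))"
    unfolding 1 by (simp add: mult_ac)
  also have "\<dots> = - coeff (hyp_poly n a b C D) j * ((real n - j) * (C + j) * (D + j))"
    unfolding ch 2 using nz by (simp add: mult_ac)
  finally show ?thesis .
next
  case False
  then have "j = n \<or> j > n" by auto
  then show ?thesis by (auto simp: coeff_hyp_poly binomial_eq_0)
qed

text \<open>The hypergeometric equation of \<open>P = hyp_poly n a b C D\<close>, written for \<open>x P'/P = h(1/x)\<close>.\<close>
lemma hyp_poly_power_sums_ode:
  fixes a b C D :: real and n :: nat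
  assumes "C > 0" "D > 0" "card {x. poly (hyp_poly n a b C D) x = 0} = n"
  defines "h \<equiv> power_sums (hyp_poly n a b C D)"
  defines "G2 \<equiv> h ^ 2 - fps_X * fps_deriv h"
  defines "G3 \<equiv> h * G2 - fps_X * fps_deriv G2"
  shows "fps_X * (G3 + fps_const (a + b - 2) * G2 + fps_const ((a - 1) * (b - 1)) * h)
    = G3 + fps_const (C + D - n) * G2 + fps_const (C * D - n * C - n * D) * h - fps_const (n * C * D)"
proof -
  let ?p = "hyp_poly n a b C D"
  define R where "R = fps_of_poly (reflect_poly ?p)"
  \<comment> \<open>\<open>R $ i\<close> is the coefficient of x^(n-i) in the polynomial, so
    \<open>E\<close> is x d/dx carried over to the reversed polynomial. By \<open>E_mult\<close>
    each application to a multiple of \<open>R\<close> gives a multiple of \<open>R\<close> again,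
    which makes the linear equation a nonlinear one for \<open>h\<close>.\<close>
  define E where "E f = of_nat n * f - fps_X * fps_deriv f" for f :: "real fps"
  have E_nth: "E f $ i = (real n - i) * f $ i" for f i
    by (cases i) (simp_all add: E_def algebra_simps fps_of_nat[symmetric])
  have E_mult: "E (g * R) = (g * h - fps_X * fps_deriv g) * R" for g
  proof -
    have "E (g * R) = g * (of_nat n * R - fps_X * fps_deriv R) - fps_X * fps_deriv g * R"
      by (simp add: E_def algebra_simps)
    also have "of_nat n * R - fps_X * fps_deriv R = h * R"
      using power_sums_log_derivative[of ?p] assms lead_coeff_hyp_poly[of n a b C D] by (simp add: R_def h_def)
    finally show ?thesis by (simp add: algebra_simps)
  qed
  have 1: "E R = h * R" using E_mult[of 1] by simp
  have 2: "E (E R) = G2 * R" unfolding 1 E_mult by (simp add: G2_def power2_eq_square)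
  have 3: "E (E (E R)) = G3 * R" unfolding 2 E_mult by (simp add: G3_def mult.commute)
  have R_nth: "R $ i = (if i \<le> n then coeff ?p (n - i) else 0)" for i
    by (simp add: R_def coeff_reflect_poly lead_coeff_hyp_poly)
  \<comment> \<open>In factored form: X E(E + a - 1)(E + b - 1) R = (E - n)(E + C)(E + D) R.
    Coefficientwise this is the two-term recurrence \<open>hyp_poly_coeff_rec\<close>.\<close>
  have "fps_X * (E (E (E R)) + fps_const (a + b - 2) * E (E R) + fps_const ((a - 1) * (b - 1)) * E R)
    = E (E (E R)) + fps_const (C + D - n) * E (E R) + fps_const (C * D - n * C - n * D) * E R - fps_const (n * C * D) * R"
    (is "?L = ?R")
  proof (rule fps_ext)
    fix i
    show "?L $ i = ?R $ i"
    proof (cases i)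
      case 0
      then show ?thesis by (simp add: E_nth algebra_simps)
    next
      case (Suc k)
      define s where "s = real n - real k"
      have "?L $ i = s * (s + a - 1) * (s + b - 1) * R $ k"
        by (simp add: Suc E_nth s_def algebra_simps)
      moreover have "?R $ i = - ((real k + 1) * (s - 1 + C) * (s - 1 + D) * R $ Suc k)"
        by (simp add: Suc E_nth s_def algebra_simps)
      moreover have "s * (s + a - 1) * (s + b - 1) * R $ k = - ((real k + 1) * (s - 1 + C) * (s - 1 + D) * R $ Suc k)"
      proof (cases "k < n")
        case True
        define j where "j = n - Suc k"
        have j: "n - k = Suc j" "n - Suc k = j" "s = real j + 1" "real n - real j = real k + 1"
          using True by (auto simp: j_def s_def of_nat_diff)
        show ?thesis
          using hyp_poly_coeff_rec[OF assms(1,2), of n a b j] True unfolding R_nth j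
          by (simp add: j mult_ac add_ac)
      qed (auto simp: R_nth s_def)
      ultimately show ?thesis by simp
    qed
  qed
  then have "(fps_X * (G3 + fps_const (a + b - 2) * G2 + fps_const ((a - 1) * (b - 1)) * h)) * R
    = (G3 + fps_const (C + D - n) * G2 + fps_const (C * D - n * C - n * D) * h - fps_const (n * C * D)) * R"
    unfolding 1[symmetric] 2[symmetric] 3[symmetric] distrib_right left_diff_distrib mult.assoc
    by (simp only: 1 2 3 mult.assoc)
  moreover have "R \<noteq> 0"
    using R_nth[of 0] lead_coeff_hyp_poly[of n a b C D] by auto
  ultimately show ?thesis by simp
qed

text \<open>An algebraic series satisfies a linear differential equation. Here it is found by
  expressing the first two derivatives \<open>V\<close> and \<open>W\<close> with respect to X d/dX
  as polynomials in \<open>U\<close>, and it turns out to be hypergeometric of order two, hence a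
  two-term recurrence.\<close>

lemma power_sums_limit_recurrence:
  fixes U :: "real fps"
  assumes cubic: "4 * U ^ 3 - 3 * U - 1 = 4 * fps_X * U ^ 3" and U0: "U $ 0 = 1"
  shows "U $ k = pochhammer (1/3) k * pochhammer (2/3) k / (pochhammer (1/2) k * fact k)"
proof -
  define V where "V = fps_X * fps_deriv U"
  define W where "W = fps_X * fps_deriv V"
  have nz: "2 * U + 1 \<noteq> 0" "U \<noteq> 0"
    using U0 by (auto simp: fps_eq_iff intro!: exI[of _ 0])
  have "fps_deriv (4 * U ^ 3 - 3 * U - 1) = fps_deriv (4 * fps_X * U ^ 3)"
    by (simp only: cubic)
  then have "12 * U ^ 2 * fps_deriv U - 3 * fps_deriv U = 4 * U ^ 3 + 12 * fps_X * U ^ 2 * fps_deriv U"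
    by (simp add: fps_deriv_power algebra_simps power2_eq_square power3_eq_cube)
  then have "fps_X * (12 * U ^ 2 * fps_deriv U - 3 * fps_deriv U) = fps_X * (4 * U ^ 3 + 12 * fps_X * U ^ 2 * fps_deriv U)"
    by simp
  then have d: "V * (12 * U ^ 2 - 3) = 4 * fps_X * U ^ 3 + 12 * fps_X * U ^ 2 * V"
    unfolding V_def by algebra
  \<comment> \<open>4 U^3 - 3 U - 1 = (U - 1)(2 U + 1)^2. Once X is eliminated by the cubic, the
    double factor cancels, as \<open>2 * U + 1\<close> has constant coefficient 3.\<close>
  have "(2 * U + 1) * (2 * U + 1) * (3 * V) = (2 * U + 1) * (2 * U + 1) * (2 * U ^ 3 - U ^ 2 - U)"
    using d cubic by algebra
  then have V: "3 * V = 2 * U ^ 3 - U ^ 2 - U" using nz by simp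
  have "fps_X * fps_deriv (3 * V) = fps_X * fps_deriv (2 * U ^ 3 - U ^ 2 - U)" by (simp only: V)
  then have W: "3 * W = 6 * U ^ 2 * V - 2 * U * V - V"
    unfolding W_def V_def
    by (simp add: fps_deriv_power algebra_simps power2_eq_square power3_eq_cube)
  \<comment> \<open>The factor \<open>U ^ 3\<close> lets the cubic replace X U^3. With \<theta> = X
    d/dX the resulting equation is \<theta>(\<theta> - 1/2) U = X (\<theta> + 1/3)(\<theta> + 2/3)
    U, multiplied by 18.\<close>
  have "U ^ 3 * (18 * W - 9 * V) = U ^ 3 * (fps_X * (18 * W + 18 * V + 4 * U))"
    using V W cubic by algebra
  then have ode: "18 * W - 9 * V = fps_X * (18 * W + 18 * V + 4 * U)" using nz by simp
  have V_nth: "V $ k = k * U $ k" for k by (cases k) (simp_all add: V_def)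
  have W_nth: "W $ k = k * (k * U $ k)" for k by (cases k) (simp_all add: W_def V_nth)
  have rec: "U $ Suc k = (1/3 + k) * (2/3 + k) / ((1/2 + k) * (1 + k)) * U $ k" for k
  proof -
    have num: "(numeral v * f) $ k = numeral v * f $ k" for v and f :: "real fps" and k
      by (simp add: numeral_fps_const)
    have "(18 * W - 9 * V) $ Suc k = (fps_X * (18 * W + 18 * V + 4 * U)) $ Suc k" by (simp only: ode)
    then have "18 * (real (Suc k) * (real (Suc k) * U $ Suc k)) - 9 * (real (Suc k) * U $ Suc k)
        = 18 * (k * (k * U $ k)) + 18 * (k * U $ k) + 4 * U $ k"
      by (simp only: fps_sub_nth fps_add_nth num V_nth W_nth fps_X_mult_nth) simp
    moreover define P Q where "P = (1/3 + real k) * (2/3 + real k)" and "Q = (1/2 + real k) * (1 + real k)"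
    ultimately have "18 * Q * U $ Suc k = 18 * P * U $ k"
      by (simp add: algebra_simps add_divide_distrib)
    moreover have "Q \<noteq> 0" by (simp add: Q_def)
    ultimately have "U $ Suc k = P / Q * U $ k" by (simp add: field_simps)
    then show ?thesis by (simp only: P_def Q_def)
  qed
  show ?thesis
    by (induction k) (simp_all add: U0 rec pochhammer_Suc mult_ac add_ac)
qed

text \<open>Isolates the two terms that contain a \<open>k\<close>-th coefficient; the truncated
  product depends on lower coefficients only, to which an induction hypothesis applies.\<close>

lemma fps_mult_nth_split:
  fixes f g :: "real fps"
  assumes "k > 0"
  shows "(f * g) $ k = (fps_cutoff k f * fps_cutoff k g) $ k + f $ 0 * g $ k + f $ k * g $ 0"
proof -
  have "(f * g) $ k = (\<Sum>i\<in>{0..k}. f $ i * g $ (k - i))"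
    by (simp add: fps_mult_nth)
  also have "{0..k} = {0<..<k} \<union> {0, k}" using assms by auto
  also have "(\<Sum>i\<in>{0<..<k} \<union> {0, k}. f $ i * g $ (k - i))
      = (\<Sum>i\<in>{0<..<k}. f $ i * g $ (k - i)) + f $ 0 * g $ k + f $ k * g $ 0"
    using assms by (subst sum.union_disjoint) auto
  also have "(\<Sum>i\<in>{0<..<k}. f $ i * g $ (k - i)) = (\<Sum>i\<in>{0..k}. fps_cutoff k f $ i * fps_cutoff k g $ (k - i))"
    by (rule sum.mono_neutral_cong_left) auto
  also have "\<dots> = (fps_cutoff k f * fps_cutoff k g) $ k"
    by (simp add: fps_mult_nth)
  finally show ?thesis .
qed

section \<open>Coefficientwise convergence of formal power series\<close>

definition fps_conv_upto :: "nat \<Rightarrow> (nat \<Rightarrow> real fps) \<Rightarrow> bool" where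
  "fps_conv_upto k F \<longleftrightarrow> (\<forall>i<k. convergent (\<lambda>n. F n $ i))"

lemma fps_conv_upto_mult:
  assumes "fps_conv_upto k F" "fps_conv_upto k G"
  shows "fps_conv_upto k (\<lambda>n. F n * G n)"
  using assms unfolding fps_conv_upto_def fps_mult_nth
  by (auto intro!: convergent_sum convergent_mult)

lemma fps_conv_upto_deriv:
  "fps_conv_upto k F \<Longrightarrow> fps_conv_upto k (\<lambda>n. fps_X * fps_deriv (F n))"
  unfolding fps_conv_upto_def
proof (intro allI impI)
  fix i assume F: "\<forall>i<k. convergent (\<lambda>n. F n $ i)" "i < k"
  have "(\<lambda>n. (fps_X * fps_deriv (F n)) $ i) = (\<lambda>n. real i * F n $ i)"
    by (cases i) auto
  then show "convergent (\<lambda>n. (fps_X * fps_deriv (F n)) $ i)"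
    using F by (simp add: convergent_mult convergent_const)
qed

lemma convergent_cutoff_mult:
  assumes "fps_conv_upto k F" "fps_conv_upto k G"
  shows "convergent (\<lambda>n. (fps_cutoff k (F n) * fps_cutoff k (G n)) $ i)"
  unfolding fps_mult_nth
proof (rule convergent_sum, rule convergent_mult)
  have *: "convergent (\<lambda>n. fps_cutoff k (F n) $ j)" if "fps_conv_upto k F" for F :: "nat \<Rightarrow> real fps" and j
    using that by (cases "j < k") (simp_all add: fps_conv_upto_def convergent_const)
  show "convergent (\<lambda>n. fps_cutoff k (F n) $ j)" "convergent (\<lambda>n. fps_cutoff k (G n) $ (i - j))" for j
    using assms * by blast+
qed

definition fps_tendsto :: "(nat \<Rightarrow> real fps) \<Rightarrow> real fps \<Rightarrow> bool" where
  "fps_tendsto F f \<longleftrightarrow> (\<forall>k. (\<lambda>n. F n $ k) \<longlonglongrightarrow> f $ k)"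

lemma fps_tendsto_add: "fps_tendsto F f \<Longrightarrow> fps_tendsto G g \<Longrightarrow> fps_tendsto (\<lambda>n. F n + G n) (f + g)"
  and fps_tendsto_diff: "fps_tendsto F f \<Longrightarrow> fps_tendsto G g \<Longrightarrow> fps_tendsto (\<lambda>n. F n - G n) (f - g)"
  and fps_tendsto_mult: "fps_tendsto F f \<Longrightarrow> fps_tendsto G g \<Longrightarrow> fps_tendsto (\<lambda>n. F n * G n) (f * g)"
  and fps_tendsto_const: "fps_tendsto (\<lambda>n. f) f"
  and fps_tendsto_scalar: "s \<longlonglongrightarrow> l \<Longrightarrow> fps_tendsto (\<lambda>n. fps_const (s n)) (fps_const l)"
  unfolding fps_tendsto_def by (auto simp: fps_mult_nth intro!: tendsto_intros)

lemma fps_tendsto_deriv: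
  assumes "fps_tendsto F f"
  shows "fps_tendsto (\<lambda>n. fps_X * fps_deriv (F n)) (fps_X * fps_deriv f)"
  unfolding fps_tendsto_def
proof
  fix k
  show "(\<lambda>n. (fps_X * fps_deriv (F n)) $ k) \<longlonglongrightarrow> (fps_X * fps_deriv f) $ k"
    using assms unfolding fps_tendsto_def by (cases k) (auto intro!: tendsto_intros)
qed

lemma fps_tendsto_unique: "fps_tendsto F f \<Longrightarrow> fps_tendsto F g \<Longrightarrow> f = g"
  unfolding fps_tendsto_def fps_eq_iff using LIMSEQ_unique by blast

text \<open>Equation of \<open>hyp_poly_power_sums_ode\<close> for \<open>u = h / n\<close>, divided by \<open>n ^ 3\<close>; here \<open>e = 1 / n\<close>,
  \<open>r = C / n\<close> and \<open>s = D / n\<close>.\<close>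
lemma scaled_power_sums_ode:
  fixes a b C D :: real and n :: nat
  assumes "n > 0" "C > 0" "D > 0" "card {x. poly (hyp_poly n a b C D) x = 0} = n"
  defines "e \<equiv> 1 / real n" and "r \<equiv> C / n" and "s \<equiv> D / n"
  defines "u \<equiv> fps_const e * power_sums (hyp_poly n a b C D)"
  defines "v \<equiv> fps_X * fps_deriv u"
  defines "w \<equiv> fps_X * fps_deriv v"
  defines "T \<equiv> u * u * u - fps_const (3 * e) * (u * v) + fps_const (e\<^sup>2) * w"
  shows "fps_X * (T + fps_const ((a + b - 2) * e) * (u * u) - fps_const ((a + b - 2) * e\<^sup>2) * v
      + fps_const ((a - 1) * (b - 1) * e\<^sup>2) * u)
    = T + fps_const (r + s - 1) * (u * u) - fps_const ((r + s - 1) * e) * v + fps_const (r * s - r - s) * u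
      - fps_const (r * s)"
proof -
  define N where "N = fps_const (real n)"
  define E where "E = fps_const e"
  \<comment> \<open>Through this relation division by \<open>n\<close> enters the final computation,
    which is a pure ring identity.\<close>
  have NE: "N * E = 1" using assms(1) by (simp add: N_def E_def e_def)
  have C: "fps_const C = N * fps_const r" and D: "fps_const D = N * fps_const s"
    using assms(1) by (simp_all add: N_def r_def s_def)
  define h where "h = power_sums (hyp_poly n a b C D)"
  have u: "u = E * h" by (simp add: u_def E_def h_def)
  have h: "h = N * u" using NE by (simp add: u mult.assoc[symmetric])
  have Xh: "fps_X * fps_deriv h = N * v"
    by (simp add: h v_def N_def)
  define G2 where "G2 = h ^ 2 - fps_X * fps_deriv h"
  have G2: "G2 = N * N * (u * u) - N * v"
    unfolding G2_def Xh by (simp add: h power2_eq_square)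
  have XG2: "fps_X * fps_deriv G2 = N * N * (2 * (u * v)) - N * w"
    by (simp add: G2 v_def w_def N_def algebra_simps)
  define G3 where "G3 = h * G2 - fps_X * fps_deriv G2"
  have "fps_X * (G3 + fps_const (a + b - 2) * G2 + fps_const ((a - 1) * (b - 1)) * h)
    = G3 + fps_const (C + D - n) * G2 + fps_const (C * D - n * C - n * D) * h - fps_const (n * C * D)"
    unfolding G3_def G2_def h_def by (rule hyp_poly_power_sums_ode[OF assms(2-4)])
  moreover have "fps_const (C + D - n) = N * fps_const (r + s - 1)"
    "fps_const (C * D - n * C - n * D) = N * N * fps_const (r * s - r - s)"
    "fps_const (n * C * D) = N * N * N * fps_const (r * s)"
    using assms(1) by (simp_all add: N_def r_def s_def field_simps power2_eq_square)
  moreover have "G3 = N * N * N * (u * u * u) - 3 * (N * N * (u * v)) + N * w"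
    unfolding G3_def XG2 by (simp add: G2 h algebra_simps)
  ultimately have eq: "fps_X * (N * N * N * (u * u * u) - 3 * (N * N * (u * v)) + N * w
      + fps_const (a + b - 2) * (N * N * (u * u) - N * v) + fps_const ((a - 1) * (b - 1)) * (N * u))
    = N * N * N * (u * u * u) - 3 * (N * N * (u * v)) + N * w
      + N * fps_const (r + s - 1) * (N * N * (u * u) - N * v) + N * N * fps_const (r * s - r - s) * (N * u) - N * N * N * fps_const (r * s)"
    by (simp only: G2 h)
  have c: "fps_const (3 * e) = 3 * E" "fps_const (e\<^sup>2) = E * E" "fps_const ((a + b - 2) * e) = fps_const (a + b - 2) * E"
    "fps_const ((a + b - 2) * e\<^sup>2) = fps_const (a + b - 2) * (E * E)" "fps_const ((a - 1) * (b - 1) * e\<^sup>2) = fps_const ((a - 1) * (b - 1)) * (E * E)"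
    "fps_const ((r + s - 1) * e) = fps_const (r + s - 1) * E"
    by (simp_all add: E_def numeral_fps_const power2_eq_square)
  show ?thesis
    unfolding T_def c using eq NE by algebra
qed

text \<open>The coefficient of \<open>u $ k\<close> in the \<open>k\<close>-th coefficient of the scaled equation tends to \<open>9/4\<close>, while all
  other terms involve only lower coefficients.\<close>
theorem scaled_power_sums_convergent:
  fixes a b :: real and C D :: "nat \<Rightarrow> real" and u :: "nat \<Rightarrow> real fps"
  assumes pos: "\<And>n. C n > 0" "\<And>n. D n > 0"
    and card: "\<And>n. card {x. poly (hyp_poly n a b (C n) (D n)) x = 0} = n"
    and lim: "(\<lambda>n. C n / n) \<longlonglongrightarrow> 1/2" "(\<lambda>n. D n / n) \<longlonglongrightarrow> 1/2"
  defines "u \<equiv> \<lambda>n. fps_const (1 / real n) * power_sums (hyp_poly n a b (C n) (D n))"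
  shows "(\<lambda>n. u n $ k) \<longlonglongrightarrow> pochhammer (1/3) k * pochhammer (2/3) k / (pochhammer (1/2) k * fact k)"
proof -
  define e where "e n = 1 / real n" for n
  define r where "r n = C n / real n" for n
  define s where "s n = D n / real n" for n
  define v where "v n = fps_X * fps_deriv (u n)" for n
  define w where "w n = fps_X * fps_deriv (v n)" for n
  define T where "T n = u n * u n * u n - fps_const (3 * e n) * (u n * v n) + fps_const ((e n)\<^sup>2) * w n" for n
  define lhs where "lhs n = T n + fps_const ((a + b - 2) * e n) * (u n * u n) - fps_const ((a + b - 2) * (e n)\<^sup>2) * v n
      + fps_const ((a - 1) * (b - 1) * (e n)\<^sup>2) * u n" for n
  define rhs where "rhs n = T n + fps_const (r n + s n - 1) * (u n * u n) - fps_const ((r n + s n - 1) * e n) * v n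
      + fps_const (r n * s n - r n - s n) * u n - fps_const (r n * s n)" for n
  have ode: "fps_X * lhs n = rhs n" if "n > 0" for n
    using scaled_power_sums_ode[OF that pos card]
    unfolding lhs_def rhs_def T_def w_def v_def u_def e_def r_def s_def by simp
  have e: "e \<longlonglongrightarrow> 0" unfolding e_def by (rule lim_1_over_n)
  have r: "r \<longlonglongrightarrow> 1/2" and s: "s \<longlonglongrightarrow> 1/2" using lim by (simp_all add: r_def[abs_def] s_def[abs_def])
  note conv_scalars = e[THEN convergentI] r[THEN convergentI] s[THEN convergentI]
  have u0: "u n $ 0 = 1" if "n > 0" for n
    using that card[of n] by (simp add: u_def power_sums_def)
  have v_nth: "v n $ i = i * u n $ i" for n i by (cases i) (simp_all add: v_def)
  have w_nth: "w n $ i = i * (i * u n $ i)" for n i by (cases i) (simp_all add: w_def v_nth)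
  have conv: "convergent (\<lambda>n. u n $ k)" for k
  proof (induction k rule: less_induct)
    case (less k)
    show ?case
    proof (cases "k = 0")
      case True
      have "(\<lambda>n. u n $ 0) \<longlonglongrightarrow> 1"
        by (rule tendsto_eventually) (use u0 in \<open>auto intro: eventually_sequentiallyI[of 1]\<close>)
      then show ?thesis by (auto simp: True convergent_def)
    next
      case False
      have cu: "fps_conv_upto k u" using less by (simp add: fps_conv_upto_def)
      have cv: "fps_conv_upto k v" unfolding v_def[abs_def] using cu by (rule fps_conv_upto_deriv)
      have cw: "fps_conv_upto k w" unfolding w_def[abs_def] using cv by (rule fps_conv_upto_deriv)
      have cuu: "fps_conv_upto k (\<lambda>n. u n * u n)" and cuv: "fps_conv_upto k (\<lambda>n. u n * v n)"
        using cu cv by (auto intro: fps_conv_upto_mult)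
      have cuuu: "fps_conv_upto k (\<lambda>n. u n * u n * u n)" using cuu cu by (rule fps_conv_upto_mult)
      \<comment> \<open>\<open>q2\<close>, \<open>q3\<close> and \<open>qv\<close> are what remains
        of the \<open>k\<close>-th coefficients of u^2, u^3 and u v when the multiples of
        \<open>u n $ k\<close> are removed.\<close>
      define q2 where "q2 n = (fps_cutoff k (u n) * fps_cutoff k (u n)) $ k" for n
      define q3 where "q3 n = q2 n + (fps_cutoff k (u n * u n) * fps_cutoff k (u n)) $ k" for n
      define qv where "qv n = (fps_cutoff k (u n) * fps_cutoff k (v n)) $ k" for n
      have conv_q: "convergent q2" "convergent q3" "convergent qv"
        unfolding q2_def[abs_def] q3_def[abs_def] qv_def[abs_def]
        by (intro convergent_add convergent_cutoff_mult cu cv cuu)+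
      have "lhs n $ (k - 1) = (u n * u n * u n) $ (k - 1) - 3 * e n * (u n * v n) $ (k - 1) + (e n)\<^sup>2 * w n $ (k - 1)
        + (a + b - 2) * e n * (u n * u n) $ (k - 1) - (a + b - 2) * (e n)\<^sup>2 * v n $ (k - 1)
        + (a - 1) * (b - 1) * (e n)\<^sup>2 * u n $ (k - 1)" for n
        by (simp add: lhs_def T_def)
      then have conv_lhs: "convergent (\<lambda>n. lhs n $ (k - 1))"
        using cu cv cw cuu cuv cuuu False unfolding fps_conv_upto_def
        by (auto intro!: convergent_add convergent_diff convergent_mult convergent_const conv_scalars simp: power2_eq_square)
      \<comment> \<open>The total factor of \<open>u n $ k\<close>: u^3, u^2 and u contribute 3, 2
        and 1 times their multipliers, the rest stems from the derivatives. Its limit is the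
        derivative of u^3 - 3u/4 - 1/4 at u = 1, where the cubic has a simple root.\<close>
      define \<mu> where "\<mu> n = 3 - 3 * e n * k + (e n)\<^sup>2 * (real k)\<^sup>2 + 2 * (r n + s n - 1) - (r n + s n - 1) * e n * k
        + (r n * s n - r n - s n)" for n
      have "\<mu> \<longlonglongrightarrow> 3 - 3 * 0 * real k + 0\<^sup>2 * (real k)\<^sup>2 + 2 * (1/2 + 1/2 - 1) - (1/2 + 1/2 - 1) * 0 * real k
        + (1/2 * (1/2) - 1/2 - 1/2)"
        unfolding \<mu>_def[abs_def] by (intro tendsto_intros e r s)
      then have \<mu>: "\<mu> \<longlonglongrightarrow> 9/4" by simp
      have eq: "lhs n $ (k - 1) = \<mu> n * u n $ k + (q3 n - 3 * e n * qv n + (r n + s n - 1) * q2 n)" if "n > 0" for n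
      proof -
        note split = fps_mult_nth_split[of k] 
        have k: "k > 0" using False by simp
        have uu: "(u n * u n) $ k = q2 n + 2 * u n $ k"
          unfolding split[OF k, of "u n" "u n"] by (simp add: q2_def u0[OF that])
        have uv: "(u n * v n) $ k = qv n + k * u n $ k"
          unfolding split[OF k, of "u n" "v n"] by (simp add: qv_def u0[OF that] v_nth)
        have uu0: "(u n * u n) $ 0 = 1" by (simp add: u0[OF that])
        have uuu: "(u n * u n * u n) $ k = q3 n + 3 * u n $ k"
          unfolding split[OF k, of "u n * u n" "u n"] uu uu0 by (simp add: q3_def u0[OF that])
        have "lhs n $ (k - 1) = rhs n $ k" using ode[OF that] k by (metis fps_X_mult_nth not_gr_zero)
        also have "\<dots> = (u n * u n * u n) $ k - 3 * e n * (u n * v n) $ k + (e n)\<^sup>2 * w n $ k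
          + (r n + s n - 1) * (u n * u n) $ k - (r n + s n - 1) * e n * v n $ k + (r n * s n - r n - s n) * u n $ k"
          using k by (simp add: rhs_def T_def)
        also have "\<dots> = \<mu> n * u n $ k + (q3 n - 3 * e n * qv n + (r n + s n - 1) * q2 n)"
          unfolding uu uv uuu v_nth w_nth \<mu>_def by (simp add: algebra_simps power2_eq_square)
        finally show ?thesis .
      qed
      define g where "g n = lhs n $ (k - 1) - (q3 n - 3 * e n * qv n + (r n + s n - 1) * q2 n)" for n
      have "convergent g"
        unfolding g_def[abs_def]
        by (intro convergent_add convergent_diff convergent_mult convergent_const conv_scalars conv_q conv_lhs)
      then obtain l where "g \<longlonglongrightarrow> l" by (auto simp: convergent_def)
      then have "(\<lambda>n. g n / \<mu> n) \<longlonglongrightarrow> l / (9/4)" using \<mu> by (intro tendsto_divide) auto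
      moreover have "eventually (\<lambda>n. \<mu> n > 0) sequentially" using \<mu> by (rule order_tendstoD) simp
      then have "eventually (\<lambda>n. g n / \<mu> n = u n $ k) sequentially"
        using eventually_gt_at_top[of 0]
      proof eventually_elim
        case (elim n)
        have "g n = \<mu> n * u n $ k" unfolding g_def eq[OF elim(2)] by simp
        then show ?case using elim(1) by simp
      qed
      ultimately have "(\<lambda>n. u n $ k) \<longlonglongrightarrow> l / (9/4)" by (rule Lim_transform_eventually)
      then show ?thesis by (auto simp: convergent_def)
    qed
  qed
  \<comment> \<open>Since all coefficients converge, the equation itself may pass to the limit; each
    derivative term carries a power of \<open>e\<close> and disappears.\<close>
  define U where "U = Abs_fps (\<lambda>k. lim (\<lambda>n. u n $ k))"
  have U: "fps_tendsto u U"
    using conv by (simp add: fps_tendsto_def U_def convergent_LIMSEQ_iff)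
  have V: "fps_tendsto v (fps_X * fps_deriv U)" unfolding v_def[abs_def] using U by (rule fps_tendsto_deriv)
  have W: "fps_tendsto w (fps_X * fps_deriv (fps_X * fps_deriv U))" unfolding w_def[abs_def] using V by (rule fps_tendsto_deriv)
  have T: "fps_tendsto T (U * U * U - fps_const (3 * 0) * (U * (fps_X * fps_deriv U)) + fps_const (0\<^sup>2) * (fps_X * fps_deriv (fps_X * fps_deriv U)))"
    unfolding T_def[abs_def] by (intro fps_tendsto_add fps_tendsto_diff fps_tendsto_mult fps_tendsto_scalar tendsto_intros e U V W)
  have "fps_tendsto (\<lambda>n. fps_X * lhs n) (fps_X * (U * U * U - fps_const (3 * 0) * (U * (fps_X * fps_deriv U)) + fps_const (0\<^sup>2) * (fps_X * fps_deriv (fps_X * fps_deriv U))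
      + fps_const ((a + b - 2) * 0) * (U * U) - fps_const ((a + b - 2) * 0\<^sup>2) * (fps_X * fps_deriv U)
      + fps_const ((a - 1) * (b - 1) * 0\<^sup>2) * U))"
    unfolding lhs_def[abs_def]
    by (intro fps_tendsto_add fps_tendsto_diff fps_tendsto_mult fps_tendsto_scalar fps_tendsto_const tendsto_intros e U V T)
  then have L: "fps_tendsto (\<lambda>n. fps_X * lhs n) (fps_X * (U * U * U))" by simp
  have "fps_tendsto rhs (U * U * U - fps_const (3 * 0) * (U * (fps_X * fps_deriv U)) + fps_const (0\<^sup>2) * (fps_X * fps_deriv (fps_X * fps_deriv U))
      + fps_const (1/2 + 1/2 - 1) * (U * U) - fps_const ((1/2 + 1/2 - 1) * 0) * (fps_X * fps_deriv U)
      + fps_const (1/2 * (1/2) - 1/2 - 1/2) * U - fps_const (1/2 * (1/2)))"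
    unfolding rhs_def[abs_def]
    by (intro fps_tendsto_add fps_tendsto_diff fps_tendsto_mult fps_tendsto_scalar fps_tendsto_const tendsto_intros e r s U V T)
  then have R: "fps_tendsto rhs (U * U * U + fps_const (-3/4) * U - fps_const (1/4))" by simp
  have "fps_tendsto rhs (fps_X * (U * U * U))"
    unfolding fps_tendsto_def
  proof
    fix k
    have "eventually (\<lambda>n. (fps_X * lhs n) $ k = rhs n $ k) sequentially"
      using eventually_gt_at_top[of 0] by eventually_elim (simp only: ode)
    moreover have "(\<lambda>n. (fps_X * lhs n) $ k) \<longlonglongrightarrow> (fps_X * (U * U * U)) $ k"
      using L unfolding fps_tendsto_def by blast
    ultimately show "(\<lambda>n. rhs n $ k) \<longlonglongrightarrow> (fps_X * (U * U * U)) $ k"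
      by (rule Lim_transform_eventually[rotated])
  qed
  from fps_tendsto_unique[OF R this]
  have "fps_const 4 * (U * U * U + fps_const (-3/4) * U - fps_const (1/4)) = fps_const 4 * (fps_X * (U * U * U))"
    by (simp only:)
  moreover have "fps_const 4 * (U * U * U + fps_const (-3/4) * U - fps_const (1/4)) = 4 * U ^ 3 - 3 * U - 1"
    by (simp add: right_diff_distrib distrib_left mult.assoc[symmetric] numeral_fps_const power3_eq_cube fps_const_neg[symmetric] del: fps_const_neg)
  ultimately have cubic: "4 * U ^ 3 - 3 * U - 1 = 4 * fps_X * U ^ 3"
    by (simp add: numeral_fps_const power3_eq_cube mult_ac)
  have "U $ 0 = 1"
  proof (rule LIMSEQ_unique)
    show "(\<lambda>n. u n $ 0) \<longlonglongrightarrow> U $ 0" using U by (simp add: fps_tendsto_def)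
    show "(\<lambda>n. u n $ 0) \<longlonglongrightarrow> 1"
      by (rule tendsto_eventually) (use u0 in \<open>auto intro: eventually_sequentiallyI[of 1]\<close>)
  qed
  have "(\<lambda>n. u n $ k) \<longlonglongrightarrow> U $ k" using U by (simp add: fps_tendsto_def)
  then show ?thesis unfolding power_sums_limit_recurrence[OF cubic \<open>U $ 0 = 1\<close>, of k] .
qed

section \<open>Weak convergence\<close>

lemma tendsto_half:
  fixes f :: "nat \<Rightarrow> nat" and c :: real
  assumes "\<And>n. real n / 2 - 1 \<le> real (f n)" "\<And>n. real (f n) \<le> real n / 2"
  shows "(\<lambda>n. (c + real (f n)) / real n) \<longlonglongrightarrow> 1/2"
proof (rule tendsto_sandwich)
  show "(\<lambda>n. (c + (real n / 2 - 1)) / real n) \<longlonglongrightarrow> 1/2" "(\<lambda>n. (c + real n / 2) / real n) \<longlonglongrightarrow> 1/2"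
    by real_asymp+
  show "eventually (\<lambda>n. (c + (real n / 2 - 1)) / real n \<le> (c + real (f n)) / real n) sequentially"
    "eventually (\<lambda>n. (c + real (f n)) / real n \<le> (c + real n / 2) / real n) sequentially"
    using assms by (auto intro!: always_eventually divide_right_mono)
qed

theorem gauss_op_power_sums_tendsto:
  fixes a b c d :: real
  assumes "a > 0" "b > 0" "c > 0" "d > 0" "min c d > max a b"
  shows "(\<lambda>n. (\<Sum>x|poly (gauss_op a b c d n) x = 0. x ^ k) / real n)
    \<longlonglongrightarrow> moment_W (2/3) (1/3) (1/2) 1 k"
proof -
  have half: "(\<lambda>n. (c + real (n div 2)) / real n) \<longlonglongrightarrow> 1/2" "(\<lambda>n. (d + real ((n - 1) div 2)) / real n) \<longlonglongrightarrow> 1/2"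
    by (rule tendsto_half; linarith)+
  have "(\<lambda>n. (fps_const (1 / real n) * power_sums (gauss_op a b c d n)) $ k)
    \<longlonglongrightarrow> pochhammer (1/3) k * pochhammer (2/3) k / (pochhammer (1/2) k * fact k)"
    unfolding gauss_op_def
    using assms gauss_op_roots(1)[OF assms, unfolded gauss_op_def]
    by (intro scaled_power_sums_convergent half) (auto intro!: add_pos_nonneg)
  then show ?thesis
    by (simp add: power_sums_def moment_W_def pochhammer_fact mult_ac)
qed

text \<open>No upper bound for the points is needed: the limit moments tend to 0, so the points above 1 carry
  asymptotically no mass, even when weighted by a fixed power.\<close>
theorem moments_imp_weak_convergence:
  fixes R :: "nat \<Rightarrow> real set" and w f :: "real \<Rightarrow> real" and m :: "nat \<Rightarrow> real"
  assumes fin: "\<And>n. finite (R n)" and card: "\<And>n. card (R n) = n" and pos: "\<And>n x. x \<in> R n \<Longrightarrow> x > 0"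
    and w: "\<And>x. 0 < x \<Longrightarrow> x < 1 \<Longrightarrow> w x \<ge> 0"
    and mom: "\<And>k. has_bochner_integral lborel (\<lambda>x. indicator {0<..<1} x *\<^sub>R (x ^ k * w x)) (m k)"
    and m0: "m 0 = 1"
    and lim: "\<And>k. (\<lambda>n. (\<Sum>x\<in>R n. x ^ k) / real n) \<longlonglongrightarrow> m k"
    and f: "continuous_on {0..1} f"
  shows "(\<lambda>n. (\<Sum>x\<in>R n \<inter> {0..1}. f x) / real n) \<longlonglongrightarrow> (LINT x:{0<..<1}|lborel. f x * w x)"
proof -
  have int: "integrable lborel (\<lambda>x. indicator {0<..<1} x *\<^sub>R (x ^ k * w x))"
    and m: "m k = (LINT x|lborel. indicator {0<..<1} x *\<^sub>R (x ^ k * w x))" for k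
    using mom[of k] by (auto simp: has_bochner_integral_iff)
  have "m \<longlonglongrightarrow> (LINT x|(lborel :: real measure). 0)"
    unfolding m[abs_def]
  proof (rule integral_dominated_convergence)
    show "integrable lborel (\<lambda>x. indicator {0<..<1} x *\<^sub>R (x ^ 0 * w x))" by (rule int)
    show "AE x in lborel. (\<lambda>k. indicator {0<..<1} x *\<^sub>R (x ^ k * w x)) \<longlonglongrightarrow> 0"
    proof (rule AE_I2)
      fix x :: real
      show "(\<lambda>k. indicator {0<..<1} x *\<^sub>R (x ^ k * w x)) \<longlonglongrightarrow> 0"
        by (cases "x \<in> {0<..<1}") (auto intro!: tendsto_mult_left_zero LIMSEQ_power_zero)
    qed
    show "AE x in lborel. norm (indicator {0<..<1} x *\<^sub>R (x ^ k * w x)) \<le> indicator {0<..<1} x *\<^sub>R (x ^ 0 * w x)" for k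
      using w by (intro AE_I2) (auto simp: indicator_def abs_mult power_le_one intro!: mult_left_le_one_le)
  qed (use int in auto)
  then have m_lim: "m \<longlonglongrightarrow> 0" by simp

  define \<tau> where "\<tau> K n = (\<Sum>x\<in>R n \<inter> {1<..}. x ^ K) / real n" for K n
  have tail: "\<tau> K \<longlonglongrightarrow> 0" for K
  proof (rule LIMSEQ_I)
    fix e :: real assume "e > 0"
    \<comment> \<open>A higher power dominates: for x > 1 and \<open>k \<ge> K\<close> the tail with
      power \<open>K\<close> is at most the full average of x^k, which tends to
      \<open>m k < e\<close>.\<close>
    then have "eventually (\<lambda>k. m k < e \<and> k \<ge> K) sequentially"
      using order_tendstoD(2)[OF m_lim] eventually_ge_at_top[of K] by (auto intro: eventually_conj)
    then obtain k where k: "m k < e" "k \<ge> K" by (auto simp: eventually_sequentially)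
    have nonneg: "\<tau> K n \<ge> 0" for n
      unfolding \<tau>_def by (intro divide_nonneg_nonneg sum_nonneg) auto
    have le: "\<tau> K n \<le> (\<Sum>x\<in>R n. x ^ k) / real n" for n
    proof -
      have "(\<Sum>x\<in>R n \<inter> {1<..}. x ^ K) \<le> (\<Sum>x\<in>R n \<inter> {1<..}. x ^ k)"
        using k by (intro sum_mono power_increasing) auto
      also have "\<dots> \<le> (\<Sum>x\<in>R n. x ^ k)"
        using fin[of n] pos[of _ n] by (intro sum_mono2) (auto intro: less_imp_le)
      finally show ?thesis unfolding \<tau>_def by (rule divide_right_mono) simp
    qed
    from order_tendstoD(2)[OF lim k(1)] obtain N where "\<And>n. n \<ge> N \<Longrightarrow> (\<Sum>x\<in>R n. x ^ k) / real n < e"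
      by (auto simp: eventually_sequentially)
    then show "\<exists>N. \<forall>n\<ge>N. norm (\<tau> K n - 0) < e"
      using le nonneg by (intro exI[of _ N]) (auto intro: le_less_trans)
  qed

  \<comment> \<open>Only points in [0, 1] are summed, as \<open>f\<close> is controlled only there;
    for polynomials the missing points are accounted for by the tails \<tau>.\<close>
  define Z where "Z g n = (\<Sum>x\<in>R n \<inter> {0..1}. g x) / real n" for g :: "real \<Rightarrow> real" and n
  define J where "J g = (LINT x:{0<..<1}|lborel. g x * w x)" for g :: "real \<Rightarrow> real"
  have w_int: "integrable lborel (\<lambda>x. indicator {0<..<1} x *\<^sub>R w x)" "(LINT x|lborel. indicator {0<..<1} x *\<^sub>R w x) = 1"
    using int[of 0] m[of 0] m0 by simp_all
  have g_int: "set_integrable lborel {0<..<1} (\<lambda>x. g x * w x)" if "continuous_on {0..1} g" for g :: "real \<Rightarrow> real"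
  proof -
    have "compact (g ` {0..1})" using that by (intro compact_continuous_image) auto
    then have "bounded (g ` {0..1})" by (rule compact_imp_bounded)
    then obtain B where "\<forall>y\<in>g ` {0..1}. norm y \<le> B" unfolding bounded_iff by (rule exE)
    then have B: "\<bar>g x\<bar> \<le> \<bar>B\<bar>" if "0 < x" "x < 1" for x
      using that by (force intro: order.trans[OF _ abs_ge_self])
    have [measurable]: "(\<lambda>x. indicator {0<..<1} x *\<^sub>R g x) \<in> borel_measurable borel"
      by (rule borel_measurable_continuous_on_indicator) (auto intro: continuous_on_subset[OF that])
    have wm [measurable]: "(\<lambda>x. indicator {0<..<1} x *\<^sub>R w x) \<in> borel_measurable borel"
      using w_int(1) by (auto dest: borel_measurable_integrable)
    have "integrable lborel (\<lambda>x. (indicator {0<..<1} x *\<^sub>R g x) * (indicator {0<..<1} x *\<^sub>R w x))"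
    proof (rule Bochner_Integration.integrable_bound)
      show "integrable lborel (\<lambda>x. B * (indicator {0<..<1} x *\<^sub>R w x))" using w_int(1) by simp
      show "AE x in lborel. norm ((indicator {0<..<1} x *\<^sub>R g x) * (indicator {0<..<1} x *\<^sub>R w x))
        \<le> norm (B * (indicator {0<..<1} x *\<^sub>R w x))"
        using B by (intro AE_I2) (auto simp: indicator_def abs_mult intro!: mult_right_mono)
    qed measurable
    moreover have "(\<lambda>x. (indicator {0<..<1} x *\<^sub>R g x) * (indicator {0<..<1} x *\<^sub>R w x))
        = (\<lambda>x. indicator {0<..<1} x *\<^sub>R (g x * w x))"
      by (auto simp: indicator_def)
    ultimately show ?thesis by (simp add: set_integrable_def)
  qed

  have poly_lim: "Z q \<longlonglongrightarrow> J q" if "q = (\<lambda>x. \<Sum>i\<le>N. \<alpha> i * x ^ i)" for q :: "real \<Rightarrow> real" and N \<alpha>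
  proof -
    have "Z q = (\<lambda>n. \<Sum>i\<le>N. \<alpha> i * ((\<Sum>x\<in>R n. x ^ i) / real n - \<tau> i n))"
    proof
      fix n
      have "R n = (R n \<inter> {0..1}) \<union> (R n \<inter> {1<..})"
        using less_imp_le[OF pos[of _ n]] by auto
      then have "(\<Sum>x\<in>R n. x ^ i) = (\<Sum>x\<in>R n \<inter> {0..1}. x ^ i) + (\<Sum>x\<in>R n \<inter> {1<..}. x ^ i)" for i
        using fin[of n] by (subst sum.union_disjoint[symmetric]) auto
      then have "(\<Sum>x\<in>R n. x ^ i) / real n - \<tau> i n = (\<Sum>x\<in>R n \<inter> {0..1}. x ^ i) / real n" for i
        by (simp add: \<tau>_def add_divide_distrib)
      moreover have "Z q n = (\<Sum>i\<le>N. \<alpha> i * ((\<Sum>x\<in>R n \<inter> {0..1}. x ^ i) / real n))"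
        unfolding Z_def that sum_divide_distrib sum_distrib_left
        by (subst sum.swap) simp
      ultimately show "Z q n = (\<Sum>i\<le>N. \<alpha> i * ((\<Sum>x\<in>R n. x ^ i) / real n - \<tau> i n))"
        by simp
    qed
    moreover have "(\<lambda>n. \<Sum>i\<le>N. \<alpha> i * ((\<Sum>x\<in>R n. x ^ i) / real n - \<tau> i n)) \<longlonglongrightarrow> (\<Sum>i\<le>N. \<alpha> i * (m i - 0))"
      by (intro tendsto_intros lim tail)
    moreover have "(\<Sum>i\<le>N. \<alpha> i * (m i - 0)) = J q"
    proof -
      have "J q = (LINT x|lborel. (\<Sum>i\<le>N. \<alpha> i * (indicator {0<..<1} x *\<^sub>R (x ^ i * w x))))"
        unfolding J_def set_lebesgue_integral_def that
        by (intro Bochner_Integration.integral_cong refl) (simp add: sum_distrib_left sum_distrib_right mult_ac)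
      also have "\<dots> = (\<Sum>i\<le>N. \<alpha> i * m i)"
        using int by (subst Bochner_Integration.integral_sum) (auto simp: m)
      finally show ?thesis by simp
    qed
    ultimately show ?thesis by simp
  qed

  have "Z f \<longlonglongrightarrow> J f"
  proof (rule LIMSEQ_I)
    fix e :: real assume e: "e > 0"
    then have "e / 3 > 0" by simp
    \<comment> \<open>A uniform error \<open>e / 3\<close> on [0, 1] costs at most
      \<open>e / 3\<close> on each side: at most \<open>n\<close> points are averaged with weight
      1/n, and \<open>w\<close> has total mass \<open>m 0 = 1\<close>.\<close>
    from Stone_Weierstrass_real_polynomial_function[OF compact_Icc f this]
    obtain q where q: "real_polynomial_function q" "\<And>x. x \<in> {0..1} \<Longrightarrow> \<bar>f x - q x\<bar> < e / 3" by auto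
    obtain \<alpha> N where \<alpha>: "q = (\<lambda>x. \<Sum>i\<le>N. \<alpha> i * x ^ i)"
      using q(1) by (auto simp: real_polynomial_function_iff_sum)
    have q_cont: "continuous_on {0..1} q" unfolding \<alpha> by (intro continuous_intros)
    have Zfq: "\<bar>Z f n - Z q n\<bar> \<le> e / 3" for n
    proof (cases "n = 0")
      case False
      have "\<bar>\<Sum>x\<in>R n \<inter> {0..1}. f x - q x\<bar> \<le> (\<Sum>x\<in>R n \<inter> {0..1}. \<bar>f x - q x\<bar>)" by (rule sum_abs)
      also have "\<dots> \<le> (\<Sum>x\<in>R n \<inter> {0..1}. e / 3)"
        using q(2) by (intro sum_mono less_imp_le) auto
      also have "\<dots> \<le> (\<Sum>x\<in>R n. e / 3)" using e fin[of n] by (intro sum_mono2) auto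
      also have "\<dots> = real n * (e / 3)" by (simp add: card)
      finally have "\<bar>\<Sum>x\<in>R n \<inter> {0..1}. f x - q x\<bar> / real n \<le> e / 3"
        using False by (simp add: field_simps)
      then show ?thesis by (simp add: Z_def sum_subtractf flip: diff_divide_distrib)
    qed (use e in \<open>simp add: Z_def\<close>)
    have Jfq: "\<bar>J f - J q\<bar> \<le> e / 3"
    proof -
      have "J f - J q = (LINT x:{0<..<1}|lborel. f x * w x - q x * w x)"
        unfolding J_def using g_int[OF f] g_int[OF q_cont] by (simp add: set_integral_diff)
      moreover have "norm (LINT x:{0<..<1}|lborel. f x * w x - q x * w x)
          \<le> (LINT x|lborel. e / 3 * (indicator {0<..<1} x *\<^sub>R w x))"
        unfolding set_lebesgue_integral_def
      proof (rule Bochner_Integration.integral_norm_bound_integral)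
        show "integrable lborel (\<lambda>x. indicator {0<..<1} x *\<^sub>R (f x * w x - q x * w x))"
          using set_integral_diff(1)[OF g_int[OF f] g_int[OF q_cont]] by (simp add: set_integrable_def)
        show "integrable lborel (\<lambda>x. e / 3 * (indicator {0<..<1} x *\<^sub>R w x))" using w_int(1) by simp
        fix x :: real
        show "norm (indicator {0<..<1} x *\<^sub>R (f x * w x - q x * w x)) \<le> e / 3 * (indicator {0<..<1} x *\<^sub>R w x)"
        proof (cases "x \<in> {0<..<1}")
          case True
          then have "\<bar>f x - q x\<bar> * w x \<le> e / 3 * w x"
            using q(2)[of x] w[of x] by (intro mult_right_mono) auto
          then show ?thesis using True w[of x] by (simp add: abs_mult flip: left_diff_distrib)
        qed simp
      qed
      ultimately show ?thesis using w_int(2) by simp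
    qed
    from LIMSEQ_D[OF poly_lim[OF \<alpha>], of "e / 3"] e
    obtain n0 where n0: "\<And>n. n \<ge> n0 \<Longrightarrow> \<bar>Z q n - J q\<bar> < e / 3" by auto
    then have "\<bar>Z f n - J f\<bar> < e" if "n \<ge> n0" for n
      using n0[OF that] Zfq[of n] Jfq by linarith
    then show "\<exists>n0. \<forall>n\<ge>n0. norm (Z f n - J f) < e" by auto
  qed
  then show ?thesis by (simp add: Z_def[abs_def] J_def)
qed

section \<open>Integrals against the two measures, and the conclusion\<close>

lemma integral_zero_counting_measure:
  assumes "p \<noteq> 0" "g \<in> borel_measurable borel"
  shows "(LINT x|zero_counting_measure p. g x) = (\<Sum>x|poly p x = 0. g x) / real (degree p)"
proof -
  let ?r = "1 / real (degree p)" and ?D = "distr (count_space {x. poly p x = 0}) borel (\<lambda>x. x)"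
  have "zero_counting_measure p = density ?D (\<lambda>_. ennreal ?r)"
    unfolding zero_counting_measure_def
    by (rule measure_eqI) (auto simp: emeasure_density_const)
  then have "(LINT x|zero_counting_measure p. g x) = (LINT x|?D. ?r *\<^sub>R g x)"
    using assms by (simp only:) (rule integral_density, auto)
  also have "\<dots> = ?r * (LINT x|?D. g x)" by simp
  also have "(LINT x|?D. g x) = (\<Sum>x|poly p x = 0. g x)"
    using assms poly_roots_finite[OF assms(1)]
    by (simp add: integral_distr lebesgue_integral_count_space_finite)
  finally show ?thesis by simp
qed

lemma integral_limit_measure:
  fixes f :: "real \<Rightarrow> real"
  assumes "continuous_on {0..1} f"
  shows "(LINT x:{0..1}|limit_measure. f x) = (LINT x:{0<..<1}|lborel. f x * limit_density x)"
proof -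
  have f: "(\<lambda>x. indicator {0..1} x *\<^sub>R f x) \<in> borel_measurable borel"
    using assms by (intro borel_measurable_continuous_on_indicator) auto
  have [measurable]: "limit_density \<in> borel_measurable borel"
    unfolding limit_density_def by measurable
  have "limit_density x \<ge> 0" for x
    by (auto simp: limit_density_def intro!: mult_nonneg_nonneg divide_nonneg_nonneg add_nonneg_nonneg)
  then have "(LINT x:{0..1}|limit_measure. f x) = (LINT x|lborel. limit_density x *\<^sub>R (indicator {0..1} x *\<^sub>R f x))"
    unfolding set_lebesgue_integral_def limit_measure_def by (intro integral_density) (use f in simp_all)
  also have "\<dots> = (LINT x:{0<..<1}|lborel. f x * limit_density x)"
    unfolding set_lebesgue_integral_def
    by (intro Bochner_Integration.integral_cong refl) (auto simp: indicator_def limit_density_def)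
  finally show ?thesis .
qed

theorem mainTheorem9:
  fixes a b c d :: real and P :: "nat \<Rightarrow> real poly"
  assumes "a > 0" and "b > 0" and "c > 0" and "d > 0"
    and "min c d > max a b"
    and "monic_2_orthogonal (weight_vec a b c d) P"
  shows "\<forall>f :: real \<Rightarrow> real. continuous_on {0..1} f \<and> bounded (f ` {0..1}) \<longrightarrow>
    (\<lambda>n. LINT x:{0..1}|zero_counting_measure (P n). f x)
      \<longlonglongrightarrow> (LINT x:{0..1}|limit_measure. f x)"
proof (intro allI impI)
  fix f :: "real \<Rightarrow> real"
  assume "continuous_on {0..1} f \<and> bounded (f ` {0..1})"
  then have f: "continuous_on {0..1} f" by simp
  define R where "R n = {x. poly (gauss_op a b c d n) x = 0}" for n
  have nz: "gauss_op a b c d n \<noteq> 0" for n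
    using lead_coeff_gauss_op[of a b c d n] by auto
  have fin: "finite (R n)" for n
    unfolding R_def using nz by (rule poly_roots_finite)
  have "(\<lambda>n. (\<Sum>x\<in>R n \<inter> {0..1}. f x) / real n) \<longlonglongrightarrow> (LINT x:{0<..<1}|lborel. f x * limit_density x)"
  proof (rule moments_imp_weak_convergence[where m = "moment_W (2/3) (1/3) (1/2) 1"])
    show "finite (R n)" for n by (rule fin)
    show "card (R n) = n" for n
      unfolding R_def by (rule gauss_op_roots(1)[OF assms(1-5)])
    show "x > 0" if "x \<in> R n" for n x
      using that unfolding R_def mem_Collect_eq by (rule gauss_op_roots(2)[OF assms(1-5)])
    show "limit_density x \<ge> 0" if "0 < x" "x < 1" for x
      unfolding limit_density_eq_weight_W[OF that] using that by (intro weight_W_nonneg) auto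
    show "moment_W (2/3) (1/3) (1/2) 1 0 = 1" by (simp add: moment_W_def)
    show "(\<lambda>n. (\<Sum>x\<in>R n. x ^ k) / real n) \<longlonglongrightarrow> moment_W (2/3) (1/3) (1/2) 1 k" for k
      unfolding R_def by (rule gauss_op_power_sums_tendsto[OF assms(1-5)])
    show "has_bochner_integral lborel (\<lambda>x. indicator {0<..<1} x *\<^sub>R (x ^ k * limit_density x))
      (moment_W (2/3) (1/3) (1/2) 1 k)" for k
    proof -
      have "has_bochner_integral lborel (\<lambda>x. indicator {0<..<1} x *\<^sub>R (x ^ k * weight_W (2/3) (1/3) (1/2) 1 x))
        (moment_W (2/3) (1/3) (1/2) 1 k)"
        unfolding moment_W_def by (rule has_bochner_integral_weight_W) auto
      moreover have "indicator {0<..<1} x *\<^sub>R (x ^ k * weight_W (2/3) (1/3) (1/2) 1 x)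
        = indicator {0<..<1} x *\<^sub>R (x ^ k * limit_density x)" for x :: real
        using limit_density_eq_weight_W[of x] by (cases "x \<in> {0<..<1}") auto
      ultimately show ?thesis by (simp only:)
    qed
  qed (rule f)
  moreover have "(LINT x:{0..1}|zero_counting_measure (P n). f x) = (\<Sum>x\<in>R n \<inter> {0..1}. f x) / real n" for n
  proof -
    have "(LINT x:{0..1}|zero_counting_measure (P n). f x)
        = (\<Sum>x\<in>R n. indicator {0..1} x *\<^sub>R f x) / real n"
      unfolding set_lebesgue_integral_def monic_2_orthogonal_eq_gauss_op[OF assms] R_def
      using integral_zero_counting_measure[OF nz[of n] borel_measurable_continuous_on_indicator[OF _ f]] by simp
    also have "(\<Sum>x\<in>R n. indicator {0..1} x *\<^sub>R f x) = (\<Sum>x\<in>R n \<inter> {0..1}. f x)"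
      using fin[of n] by (intro sum.mono_neutral_cong_right) (auto simp: indicator_def)
    finally show ?thesis .
  qed
  ultimately show "(\<lambda>n. LINT x:{0..1}|zero_counting_measure (P n). f x)
      \<longlonglongrightarrow> (LINT x:{0..1}|limit_measure. f x)"
    by (simp add: integral_limit_measure[OF f])
qed

end
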